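(* Let $B(u)$ be the generating matrix of the reflection algebra $\mathcal B(n,l)$. For $\kappa=(k_1,\dots,k_n)\in I_n$ put $$Q_\kappa^{-1}=P_{1k_1}\cdots P_{nk_n},$$ denote the corresponding element of the symmetric group by $$q_\kappa=(n,k_n)(n-1,k_{n-1})\cdots(1,k_1)\in S_n,$$ and define $$q_\kappa^{[i]}=(n,k_n)(n-1,k_{n-1})\cdots(i,k_i)\in S_n\qquad(i=1,\dots,n).$$ Then $$\langle\langle B_1,\dots,B_n\rangle\rangle=\sum_{\kappa\in I_n}\alpha(\kappa)\,Q_\kappa^{-1}\,B_{q_\kappa^{[1]}(1)}(u)\,B_{q_\kappa^{[2]}(2)}(u-1)\cdots B_{q_\kappa^{[n]}(n)}(u-n+1),$$ where $q_\kappa^{[i]}(j)$ is the result of the action of the permutation $q_\kappa^{[i]}$ on $j$.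
   Context: Reflection algebra. Let $n=m+l$ with $m,l$ nonnegative integers, and $\varepsilon_i=1$ for $1\le i\le m$, $\varepsilon_i=-1$ for $m<i\le n$. Let $P:v\otimes w\mapsto w\otimes v$ on $\mathbb C^n\otimes\mathbb C^n$ and $R(u)=1-P/u$. The reflection algebra $\mathcal B(n,l)$ is the unital associative algebra over $\mathbb C$ with generators $b_{ij}^{(r)}$ ($i,j=1,\dots,n$, $r=0,1,2,\dots$), $b_{ij}^{(0)}=\delta_{ij}\varepsilon_i$, collected into series $b_i^j(u)=\sum_{r\ge0}b_{ij}^{(r)}u^{-r}$ and the matrix $B(u)=\sum_{i,j}E_{ij}\otimes b_i^j(u)\in\operatorname{End}\mathbb C^n\otimes\mathcal B(n,l)[[u^{-1}]]$, subject to the reflection equation $R(u-v)B_1(u)R(u+v)B_2(v)=B_2(v)R(u+v)B_1(u)R(u-v)$ and the unitary condition $B(u)B(-u)=1$. For a matrix $X=(x_{ij})$ over an associative algebra $A$, $X_s=\sum_{i,j}1\otimes\cdots\otimes E_{ij}\otimes\cdots\otimes1\otimes x_{ij}\in\operatorname{End}(\mathbb C^n)^{\otimes n}\otimes A$ with $E_{ij}$ in the $s$-th position; $P_{ij}$ denotes $P$ acting on the $i$-th and $j$-th copies of $\mathbb C^n$ in $(\mathbb C^n)^{\otimes n}$, and $P_{kk}$ is the identity; likewise $(k,k)$ is the identity permutation and $(i,j)$ denotes a transposition. Products of permutations are composed from right to left. Shifted series and rational functions of $u$ are expanded as power series in $u^{-1}$. For $k=1,\dots,n$ put $\Pi_k=1-(2u-k-n+2)^{-1}\sum_{i=k+1}^nP_{ki}$,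 and $$\langle\langle B_1,\dots,B_n\rangle\rangle=B_1(u)\Pi_1B_2(u-1)\Pi_2\cdots B_{n-1}(u-n+2)\Pi_{n-1}B_n(u-n+1).$$ $I_n\subset\mathbb Z^n$ is the set of $n$-tuples $\kappa=(k_1,\dots,k_n)$ with $i\le k_i\le n$ for all $i=1,\dots,n$, and $\alpha(\kappa)=\prod_{i:\,i<k_i}\frac{1}{n-2u-2+i}$. *)

theory Defs
  imports
    "HOL-Algebra.QuotRing"
    "HOL-Computational_Algebra.Formal_Laurent_Series"
    "HOL-Library.Poly_Mapping"
    "HOL-Library.FuncSet"
    "HOL-Combinatorics.Transposition"
    "HOL.Complex"
begin

section \<open>Matrices, formal series and ordered products over a ring\<close>

definition type_ring :: "'a::ring_1 ring" where
  "type_ring = \<lparr>carrier = UNIV, monoid.mult = (*), one = 1, zero = 0, add = (+)\<rparr>"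

text \<open>Matrices are extensional, so that equality in \<open>mat_ring I R\<close> is equality of functions.\<close>

definition mk_mat :: "'i set \<Rightarrow> ('i \<Rightarrow> 'i \<Rightarrow> 'a) \<Rightarrow> 'i \<Rightarrow> 'i \<Rightarrow> 'a" where
  "mk_mat I X = (\<lambda>i\<in>I. \<lambda>j\<in>I. X i j)"

definition mat_ring :: "'i set \<Rightarrow> ('a, 'c) ring_scheme \<Rightarrow> ('i \<Rightarrow> 'i \<Rightarrow> 'a) ring" where
  "mat_ring I R =
    \<lparr>carrier = I \<rightarrow>\<^sub>E (I \<rightarrow>\<^sub>E carrier R),
     monoid.mult = (\<lambda>X Y. mk_mat I (\<lambda>i j. \<Oplus>\<^bsub>R\<^esub>k\<in>I. X i k \<otimes>\<^bsub>R\<^esub> Y k j)),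
     one = mk_mat I (\<lambda>i j. if i = j then \<one>\<^bsub>R\<^esub> else \<zero>\<^bsub>R\<^esub>),
     zero = mk_mat I (\<lambda>i j. \<zero>\<^bsub>R\<^esub>),
     add = (\<lambda>X Y. mk_mat I (\<lambda>i j. X i j \<oplus>\<^bsub>R\<^esub> Y i j))\<rparr>"

definition mat_scale ::
    "'i set \<Rightarrow> ('a, 'c) ring_scheme \<Rightarrow> 'a \<Rightarrow> ('i \<Rightarrow> 'i \<Rightarrow> 'a) \<Rightarrow> 'i \<Rightarrow> 'i \<Rightarrow> 'a" where
  "mat_scale I R c X = mk_mat I (\<lambda>i j. c \<otimes>\<^bsub>R\<^esub> X i j)"

text \<open>\<open>series_ring R\<close> is \<open>R[[u\<^sup>-\<^sup>1]]\<close>: \<open>f r\<close> is the coefficient of \<open>u\<^sup>-\<^sup>r\<close>. The type \<^typ>\<open>'a fps\<close> is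
  not available here, because the coefficient ring is a quotient that depends on parameters and
  hence not a type.\<close>

definition series_ring :: "('a, 'c) ring_scheme \<Rightarrow> (nat \<Rightarrow> 'a) ring" where
  "series_ring R =
    \<lparr>carrier = UNIV \<rightarrow> carrier R,
     monoid.mult = (\<lambda>f g r. \<Oplus>\<^bsub>R\<^esub>s\<in>{..r}. f s \<otimes>\<^bsub>R\<^esub> g (r - s)),
     one = (\<lambda>r. if r = 0 then \<one>\<^bsub>R\<^esub> else \<zero>\<^bsub>R\<^esub>),
     zero = (\<lambda>r. \<zero>\<^bsub>R\<^esub>),
     add = (\<lambda>f g r. f r \<oplus>\<^bsub>R\<^esub> g r)\<rparr>"

definition ordered_prod :: "('a, 'c) monoid_scheme \<Rightarrow> 'a list \<Rightarrow> 'a" where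
  "ordered_prod G xs = foldr (\<otimes>\<^bsub>G\<^esub>) xs \<one>\<^bsub>G\<^esub>"


section \<open>Rational functions of \<open>u\<close> and shifts of series\<close>

text \<open>Formal Laurent series have finitely many terms of negative degree in their variable, so the
  variable is taken to be \<open>u\<^sup>-\<^sup>1\<close>; then \<open>u\<close> itself is \<^const>\<open>fls_X_inv\<close>, and an arithmetic expression
  in \<open>u\<close> in the field \<^typ>\<open>complex fls\<close> is the expansion of a rational function at infinity.\<close>

abbreviation uvar :: "complex fls" where
  "uvar \<equiv> fls_X_inv"

text \<open>In the next two definitions \<open>\<iota>\<close> is the structure map of a complex algebra \<open>R\<close>. The first one
  is only used for expansions without positive powers of \<open>u\<close>. In the second one, \<open>(u - c)\<^sup>-\<^sup>r\<close> has
  no terms \<open>u\<^sup>-\<^sup>s\<close> with \<open>s < r\<close>, so the sum is the coefficient of \<open>u\<^sup>-\<^sup>s\<close> in \<open>f(u - c)\<close>.\<close>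

definition expand :: "(complex \<Rightarrow> 'a) \<Rightarrow> complex fls \<Rightarrow> nat \<Rightarrow> 'a" where
  "expand \<iota> f = (\<lambda>r. \<iota> (fls_nth f (int r)))"

definition shift_series ::
    "(complex \<Rightarrow> 'a) \<Rightarrow> ('a, 'c) ring_scheme \<Rightarrow> nat \<Rightarrow> (nat \<Rightarrow> 'a) \<Rightarrow> nat \<Rightarrow> 'a" where
  "shift_series \<iota> R c f =
    (\<lambda>s. \<Oplus>\<^bsub>R\<^esub>r\<in>{..s}. \<iota> (fls_nth ((1 / (uvar - of_nat c)) ^ r) (int s)) \<otimes>\<^bsub>R\<^esub> f r)"


section \<open>Tensor powers\<close>

text \<open>The standard basis of \<open>(\<complex>\<^sup>n)\<^sup>\<otimes>\<^sup>N\<close> is indexed by the maps \<open>{1..N} \<rightarrow> {1..n}\<close>, and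
  \<open>End(\<complex>\<^sup>n)\<^sup>\<otimes>\<^sup>N \<otimes> A\<close> is identified with the \<open>A\<close>-valued matrices over this index set.\<close>

definition tensor_basis :: "nat \<Rightarrow> nat \<Rightarrow> (nat \<Rightarrow> nat) set" where
  "tensor_basis n N = {1..N} \<rightarrow>\<^sub>E {1..n}"

definition at_site ::
    "nat \<Rightarrow> nat \<Rightarrow> ('a, 'c) ring_scheme \<Rightarrow> nat \<Rightarrow> (nat \<Rightarrow> nat \<Rightarrow> 'a)
      \<Rightarrow> (nat \<Rightarrow> nat) \<Rightarrow> (nat \<Rightarrow> nat) \<Rightarrow> 'a" where
  "at_site n N R s X = mk_mat (tensor_basis n N)
    (\<lambda>a b. if \<forall>t\<in>{1..N} - {s}. a t = b t then X (a s) (b s) else \<zero>\<^bsub>R\<^esub>)"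

text \<open>\<open>P\<^sub>i\<^sub>j\<close> maps the basis vector with index \<open>b\<close> to the one with index \<open>b \<circ> (i j)\<close>; it is the
  identity for \<open>i = j\<close>.\<close>

definition flip_op ::
    "nat \<Rightarrow> nat \<Rightarrow> ('a, 'c) ring_scheme \<Rightarrow> nat \<Rightarrow> nat
      \<Rightarrow> (nat \<Rightarrow> nat) \<Rightarrow> (nat \<Rightarrow> nat) \<Rightarrow> 'a" where
  "flip_op n N R i j = mk_mat (tensor_basis n N)
    (\<lambda>a b. if a = b \<circ> Transposition.transpose i j then \<one>\<^bsub>R\<^esub> else \<zero>\<^bsub>R\<^esub>)"


section \<open>The free algebra\<close>

datatype 'a word = Word (letters: "'a list")

instantiation word :: (type) monoid_add
begin

definition zero_word :: "'a word" where
  "zero_word = Word []"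

definition plus_word :: "'a word \<Rightarrow> 'a word \<Rightarrow> 'a word" where
  "plus_word x y = Word (letters x @ letters y)"

instance
  by standard (simp_all add: zero_word_def plus_word_def)

end

text \<open>With concatenation as the addition of words, the product of \<^typ>\<open>'a word \<Rightarrow>\<^sub>0 complex\<close> is the
  multiplication of noncommutative polynomials.\<close>

definition free_algebra :: "'a set \<Rightarrow> ('a word \<Rightarrow>\<^sub>0 complex) ring" where
  "free_algebra S =
    \<lparr>carrier = {p. \<forall>w\<in>Poly_Mapping.keys p. set (letters w) \<subseteq> S},
     monoid.mult = (*), one = 1, zero = 0, add = (+)\<rparr>"

definition free_const :: "complex \<Rightarrow> 'a word \<Rightarrow>\<^sub>0 complex" where
  "free_const c = Poly_Mapping.single 0 c"


section \<open>The reflection algebra \<open>\<B>(m + l, l)\<close>\<close>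

text \<open>The letter \<open>(i, j, r)\<close> stands for the generator \<open>b\<^sub>i\<^sub>j\<^sup>(\<^sup>r\<^sup>)\<close>.\<close>

type_synonym free_elem = "(nat \<times> nat \<times> nat) word \<Rightarrow>\<^sub>0 complex"

definition letter_set :: "nat \<Rightarrow> (nat \<times> nat \<times> nat) set" where
  "letter_set n = {1..n} \<times> {1..n} \<times> UNIV"

definition gen :: "nat \<Rightarrow> nat \<Rightarrow> nat \<Rightarrow> free_elem" where
  "gen i j r = Poly_Mapping.single (Word [(i, j, r)]) 1"

definition signature :: "nat \<Rightarrow> nat \<Rightarrow> complex" where
  "signature m i = (if i \<le> m then 1 else -1)"

definition initial_rels :: "nat \<Rightarrow> nat \<Rightarrow> free_elem set" where
  "initial_rels m l = {gen i j 0 - free_const (if i = j then signature m i else 0) | i j.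
     i \<in> {1..m + l} \<and> j \<in> {1..m + l}}"

text \<open>The coefficients of \<open>B(u) B(-u) - 1\<close>; here \<^const>\<open>fps_X\<close> is \<open>u\<^sup>-\<^sup>1\<close>.\<close>

definition unitary_rels :: "nat \<Rightarrow> free_elem set" where
  "unitary_rels n =
    (let M = mat_ring {1..n} (type_ring :: free_elem fps ring);
         B = mk_mat {1..n} (\<lambda>i j. Abs_fps (\<lambda>r. gen i j r));
         B' = mk_mat {1..n} (\<lambda>i j. Abs_fps (\<lambda>r. (- 1) ^ r * gen i j r))
     in {fps_nth ((B \<otimes>\<^bsub>M\<^esub> B') i j - \<one>\<^bsub>M\<^esub> i j) r | i j r. i \<in> {1..n} \<and> j \<in> {1..n}})"

text \<open>The reflection equation is expanded in the region \<open>|u| > |v|\<close>, i.e. over the Laurent series in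
  \<open>u\<^sup>-\<^sup>1\<close> whose coefficients are Laurent series in \<open>v\<^sup>-\<^sup>1\<close>. Since \<open>u\<^sup>2 - v\<^sup>2\<close> is a central unit there,
  this gives the same ideal as the equation multiplied by \<open>u\<^sup>2 - v\<^sup>2\<close>.\<close>

definition u_in :: "free_elem fls fls" where
  "u_in = fls_X_inv"

definition v_in :: "free_elem fls fls" where
  "v_in = fls_const fls_X_inv"

text \<open>\<open>geom t = (u - t)\<^sup>-\<^sup>1 = \<Sum>k. t\<^sup>k u\<^sup>-\<^sup>k\<^sup>-\<^sup>1\<close>\<close>

definition geom :: "free_elem fls \<Rightarrow> free_elem fls fls" where
  "geom t = fps_to_fls (fps_X * Abs_fps (\<lambda>k. t ^ k))"

lemma geom_minus: "geom fls_X_inv * (u_in - v_in) = 1"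
  and geom_plus: "geom (- fls_X_inv) * (u_in + v_in) = 1"
proof -
  have *: "geom t * (u_in - fls_const t) = 1" for t
  proof (rule fls_eqI)
    fix k :: int
    have 1: "fls_nth (geom t * (u_in - fls_const t)) k
        = fls_nth (geom t) (k + 1) - fls_nth (geom t) k * t"
      by (simp add: u_in_def right_diff_distrib fls_X_inv_times_conv_shift)
    have 2: "fls_nth (geom t) j = (if j \<ge> 1 then t ^ nat (j - 1) else 0)" for j
      by (auto simp: geom_def nat_diff_distrib)
    show "fls_nth (geom t * (u_in - fls_const t)) k = fls_nth 1 k"
    proof (cases "k \<ge> 1")
      case True
      then have "nat k = Suc (nat (k - 1))" by simp
      then show ?thesis unfolding 1 2 using True by (simp add: power_commutes del: nat_diff_distrib)
    qed (auto simp: 1 2)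
  qed
  show "geom fls_X_inv * (u_in - v_in) = 1" using *[of fls_X_inv] by (simp add: v_in_def)
  show "geom (- fls_X_inv) * (u_in + v_in) = 1" using *[of "- fls_X_inv"]
    unfolding v_in_def fls_const_uminus[symmetric] by simp
qed

definition reflection_rels :: "nat \<Rightarrow> free_elem set" where
  "reflection_rels n =
    (let K = (type_ring :: free_elem fls fls ring);
         M = mat_ring (tensor_basis n 2) K;
         R = (\<lambda>w. \<one>\<^bsub>M\<^esub> \<ominus>\<^bsub>M\<^esub> mat_scale (tensor_basis n 2) K w (flip_op n 2 K 1 2));
         R\<^sub>m = R (geom fls_X_inv);
         R\<^sub>p = R (geom (- fls_X_inv));
         B\<^sub>1 = at_site n 2 K 1 (\<lambda>i j. fps_to_fls (Abs_fps (\<lambda>r. fls_const (gen i j r))));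
         B\<^sub>2 = at_site n 2 K 2 (\<lambda>i j. fls_const (fps_to_fls (Abs_fps (\<lambda>r. gen i j r))));
         L = ordered_prod M [R\<^sub>m, B\<^sub>1, R\<^sub>p, B\<^sub>2];
         L' = ordered_prod M [B\<^sub>2, R\<^sub>p, B\<^sub>1, R\<^sub>m]
     in {fls_nth (fls_nth (L a b - L' a b) p) q | a b p q.
           a \<in> tensor_basis n 2 \<and> b \<in> tensor_basis n 2})"

definition reflection_ideal :: "nat \<Rightarrow> nat \<Rightarrow> free_elem set" where
  "reflection_ideal m l = Idl\<^bsub>free_algebra (letter_set (m + l))\<^esub>
     (initial_rels m l \<union> unitary_rels (m + l) \<union> reflection_rels (m + l))"

definition reflection_algebra :: "nat \<Rightarrow> nat \<Rightarrow> free_elem set ring" where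
  "reflection_algebra m l = free_algebra (letter_set (m + l)) Quot reflection_ideal m l"

text \<open>All relations lie in the free algebra on \<open>letter_set (m + l)\<close>, so that \<^const>\<open>reflection_ideal\<close>
  is the two-sided ideal they generate, rather than an intersection over an empty family.\<close>

lemma type_ring_ring: "ring (type_ring :: 'a::ring_1 ring)"
proof (rule ringI)
  show "abelian_group (type_ring :: 'a::ring_1 ring)"
    by (rule abelian_groupI) (auto simp: type_ring_def algebra_simps intro: exI[of _ "- _"] left_minus)
  show "Group.monoid (type_ring :: 'a::ring_1 ring)"
    by (rule monoidI) (auto simp: type_ring_def algebra_simps)
qed (auto simp: type_ring_def algebra_simps)

lemma free_algebra_simps [simp]:
  "x \<otimes>\<^bsub>free_algebra S\<^esub> y = x * y" "x \<oplus>\<^bsub>free_algebra S\<^esub> y = x + y"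
  "\<one>\<^bsub>free_algebra S\<^esub> = 1" "\<zero>\<^bsub>free_algebra S\<^esub> = 0"
  by (simp_all add: free_algebra_def)

lemma free_algebra_carrier:
  "p \<in> carrier (free_algebra S) \<longleftrightarrow> (\<forall>w\<in>Poly_Mapping.keys p. set (letters w) \<subseteq> S)"
  by (simp add: free_algebra_def)

lemma free_algebra_closed:
  shows fa0: "0 \<in> carrier (free_algebra S)" and fa1: "1 \<in> carrier (free_algebra S)"
    and fa_add: "x \<in> carrier (free_algebra S) \<Longrightarrow> y \<in> carrier (free_algebra S) \<Longrightarrow> x + y \<in> carrier (free_algebra S)"
    and fa_diff: "x \<in> carrier (free_algebra S) \<Longrightarrow> y \<in> carrier (free_algebra S) \<Longrightarrow> x - y \<in> carrier (free_algebra S)"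
    and fa_mult: "x \<in> carrier (free_algebra S) \<Longrightarrow> y \<in> carrier (free_algebra S) \<Longrightarrow> x * y \<in> carrier (free_algebra S)"
    and fa_uminus: "x \<in> carrier (free_algebra S) \<Longrightarrow> - x \<in> carrier (free_algebra S)"
    and fa_const: "free_const c \<in> carrier (free_algebra S)"
  unfolding free_algebra_carrier
  using keys_add[of x y] keys_diff[of x y] keys_mult[of x y]
  by (auto simp: zero_word_def free_const_def plus_word_def subset_iff dest!: set_mp) (force+)?

lemma fa_gen: "i \<in> {1..n} \<Longrightarrow> j \<in> {1..n} \<Longrightarrow> gen i j r \<in> carrier (free_algebra (letter_set n))"
  by (simp add: free_algebra_carrier gen_def letter_set_def)

lemma free_algebra_ring: "ring (free_algebra S)"
proof (rule ringI)
  show "abelian_group (free_algebra S)"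
    by (rule abelian_groupI) (auto simp: algebra_simps fa0 fa_add intro!: bexI[of _ "- _"] fa_uminus)
  show "Group.monoid (free_algebra S)"
    by (rule monoidI) (auto simp: algebra_simps fa1 fa_mult)
qed (auto simp: algebra_simps)


lemma mat_simps:
  "carrier (mat_ring I R) = I \<rightarrow>\<^sub>E (I \<rightarrow>\<^sub>E carrier R)"
  "X \<otimes>\<^bsub>mat_ring I R\<^esub> Y = mk_mat I (\<lambda>i j. \<Oplus>\<^bsub>R\<^esub>k\<in>I. X i k \<otimes>\<^bsub>R\<^esub> Y k j)"
  "\<one>\<^bsub>mat_ring I R\<^esub> = mk_mat I (\<lambda>i j. if i = j then \<one>\<^bsub>R\<^esub> else \<zero>\<^bsub>R\<^esub>)"
  "\<zero>\<^bsub>mat_ring I R\<^esub> = mk_mat I (\<lambda>i j. \<zero>\<^bsub>R\<^esub>)"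
  "X \<oplus>\<^bsub>mat_ring I R\<^esub> Y = mk_mat I (\<lambda>i j. X i j \<oplus>\<^bsub>R\<^esub> Y i j)"
  by (simp_all add: mat_ring_def)

lemma mk_mat_nth [simp]: "i \<in> I \<Longrightarrow> j \<in> I \<Longrightarrow> mk_mat I X i j = X i j"
  by (simp add: mk_mat_def)

lemma mat_eqI:
  assumes "X \<in> I \<rightarrow>\<^sub>E (I \<rightarrow>\<^sub>E A)" "Y \<in> I \<rightarrow>\<^sub>E (I \<rightarrow>\<^sub>E A)"
    and "\<And>i j. i \<in> I \<Longrightarrow> j \<in> I \<Longrightarrow> X i j = Y i j"
  shows "X = Y"
proof (rule PiE_ext[OF assms(1,2)])
  fix i assume "i \<in> I"
  then show "X i = Y i" using assms by (intro PiE_ext[of "X i" I "\<lambda>_. A" "Y i"]) auto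
qed

lemma mk_mat_mem: "(\<And>i j. i \<in> I \<Longrightarrow> j \<in> I \<Longrightarrow> X i j \<in> A) \<Longrightarrow> mk_mat I X \<in> I \<rightarrow>\<^sub>E (I \<rightarrow>\<^sub>E A)"
  by (auto simp: mk_mat_def)

lemma mat_mem: "X \<in> I \<rightarrow>\<^sub>E (I \<rightarrow>\<^sub>E A) \<Longrightarrow> i \<in> I \<Longrightarrow> j \<in> I \<Longrightarrow> X i j \<in> A"
  by (auto simp: PiE_iff)

lemma mat_abelian_group:
  assumes "ring R"
  shows "abelian_group (mat_ring I R)"
proof -
  interpret ring R by fact
  show ?thesis
  proof (rule abelian_groupI, unfold mat_simps)
    fix X assume X: "X \<in> I \<rightarrow>\<^sub>E (I \<rightarrow>\<^sub>E carrier R)"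
    show "\<exists>Y\<in>I \<rightarrow>\<^sub>E (I \<rightarrow>\<^sub>E carrier R). mk_mat I (\<lambda>i j. Y i j \<oplus>\<^bsub>R\<^esub> X i j) = mk_mat I (\<lambda>i j. \<zero>\<^bsub>R\<^esub>)"
      by (rule bexI[of _ "mk_mat I (\<lambda>i j. \<ominus>\<^bsub>R\<^esub> X i j)"])
        (auto intro!: mk_mat_mem mat_eqI[of _ I "carrier R"] simp: l_neg mat_mem[OF X])
  qed (auto intro!: mk_mat_mem mat_eqI[of _ I "carrier R"] simp: mat_mem a_ac)
qed

lemma mat_minus_nth:
  assumes "ring R" and X: "X \<in> carrier (mat_ring I R)" and Y: "Y \<in> carrier (mat_ring I R)"
    and ij: "i \<in> I" "j \<in> I"
  shows "(X \<ominus>\<^bsub>mat_ring I R\<^esub> Y) i j = X i j \<ominus>\<^bsub>R\<^esub> Y i j"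
proof -
  interpret R: ring R by fact
  interpret M: abelian_group "mat_ring I R" using mat_abelian_group[OF assms(1)] .
  have "(\<ominus>\<^bsub>mat_ring I R\<^esub> Y \<oplus>\<^bsub>mat_ring I R\<^esub> Y) i j = \<zero>\<^bsub>R\<^esub>"
    using ij by (simp only: M.l_neg[OF Y]) (simp add: mat_simps)
  then have "(\<ominus>\<^bsub>mat_ring I R\<^esub> Y) i j \<oplus>\<^bsub>R\<^esub> Y i j = \<zero>\<^bsub>R\<^esub>"
    using ij by (simp add: mat_simps)
  moreover have "Y i j \<in> carrier R" "(\<ominus>\<^bsub>mat_ring I R\<^esub> Y) i j \<in> carrier R"
    using Y M.a_inv_closed[OF Y] ij by (auto simp: mat_simps mat_mem)
  ultimately have "(\<ominus>\<^bsub>mat_ring I R\<^esub> Y) i j = \<ominus>\<^bsub>R\<^esub> Y i j"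
    using R.minus_equality by metis
  then show ?thesis using ij unfolding a_minus_def by (simp add: mat_simps)
qed

lemma type_ring_simps:
  "carrier type_ring = UNIV" "x \<otimes>\<^bsub>type_ring\<^esub> y = x * y" "x \<oplus>\<^bsub>type_ring\<^esub> y = x + y"
  "\<one>\<^bsub>type_ring\<^esub> = 1" "\<zero>\<^bsub>type_ring\<^esub> = 0"
  by (simp_all add: type_ring_def)

lemma type_ring_finsum:
  fixes f :: "'i \<Rightarrow> 'a::ring_1"
  shows "finite A \<Longrightarrow> (\<Oplus>\<^bsub>type_ring\<^esub>i\<in>A. f i) = (\<Sum>i\<in>A. f i)"
proof (induction A rule: finite_induct)
  case empty
  interpret ring "type_ring :: 'a ring" by (rule type_ring_ring)
  show ?case by (simp add: type_ring_simps)
next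
  case (insert x F)
  interpret ring "type_ring :: 'a ring" by (rule type_ring_ring)
  show ?case using insert by (subst finsum_insert) (auto simp: type_ring_simps)
qed

lemma type_ring_minus: "(x :: 'a::ring_1) \<ominus>\<^bsub>type_ring\<^esub> y = x - y"
proof -
  interpret ring "type_ring :: 'a ring" by (rule type_ring_ring)
  have "\<ominus>\<^bsub>type_ring\<^esub> y = - y" by (rule minus_equality) (auto simp: type_ring_simps)
  then show ?thesis by (simp add: a_minus_def type_ring_simps)
qed

lemma sum_closed:
  assumes "(0::'a::comm_monoid_add) \<in> D" "\<And>x y. x \<in> D \<Longrightarrow> y \<in> D \<Longrightarrow> x + y \<in> D"
    and "\<And>i. i \<in> A \<Longrightarrow> f i \<in> D"
  shows "sum f A \<in> D"
  using assms by (induction A rule: infinite_finite_induct) auto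

lemma fa_sum: "(\<And>i. i \<in> A \<Longrightarrow> f i \<in> carrier (free_algebra S)) \<Longrightarrow> sum f A \<in> carrier (free_algebra S)"
  by (rule sum_closed) (auto simp: fa0 fa_add)

lemma initial_rels_carrier: "initial_rels m l \<subseteq> carrier (free_algebra (letter_set (m + l)))"
  by (auto simp: initial_rels_def intro!: fa_diff fa_gen fa_const)

lemma unitary_rels_carrier: "unitary_rels n \<subseteq> carrier (free_algebra (letter_set n))"
proof -
  have m1: "(- 1) ^ r * x \<in> carrier (free_algebra S)" if "x \<in> carrier (free_algebra S)" for r x S
    using that by (cases "even r") (auto intro: fa_uminus)
  show ?thesis
    unfolding unitary_rels_def Let_def
    by (auto simp: mat_simps type_ring_simps type_ring_finsum fps_sum_nth fps_mult_nth
        intro!: fa_diff fa_sum fa_mult fa_gen m1 fa0 fa1)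
qed

definition coeffs_in :: "'a::zero set \<Rightarrow> 'a fls fls set" where
  "coeffs_in A = {f. \<forall>p q. fls_nth (fls_nth f p) q \<in> A}"

lemma reflection_rels_carrier: "reflection_rels n \<subseteq> carrier (free_algebra (letter_set n))"
proof -
  let ?A = "carrier (free_algebra (letter_set n))"
  let ?D = "coeffs_in ?A"
  let ?I = "tensor_basis n 2"
  let ?K = "type_ring :: free_elem fls fls ring"
  let ?M = "mat_ring ?I ?K"
  let ?E = "?I \<rightarrow>\<^sub>E (?I \<rightarrow>\<^sub>E ?D)"
  have fin: "finite ?I" by (simp add: tensor_basis_def finite_PiE)
  have D0: "0 \<in> ?D" and D1: "1 \<in> ?D" by (auto simp: coeffs_in_def fa0 fa1)
  have Dadd: "x + y \<in> ?D" and Ddiff: "x - y \<in> ?D" if "x \<in> ?D" "y \<in> ?D" for x y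
    using that by (auto simp: coeffs_in_def fa_add fa_diff)
  have mult1: "fls_nth (f * g) q \<in> ?A" if "\<And>q. fls_nth f q \<in> ?A" "\<And>q. fls_nth g q \<in> ?A"
    for f g :: "free_elem fls" and q
    unfolding fls_times_nth(1) using that by (intro fa_sum fa_mult) auto
  have nth_sum: "fls_nth (sum h B) q = (\<Sum>i\<in>B. fls_nth (h i) q)"
    for h :: "int \<Rightarrow> free_elem fls" and B q
    by (induction B rule: infinite_finite_induct) auto
  have Dmult: "x * y \<in> ?D" if "x \<in> ?D" "y \<in> ?D" for x y
    unfolding coeffs_in_def mem_Collect_eq fls_times_nth(1) nth_sum
    using that by (intro allI fa_sum mult1) (simp_all add: coeffs_in_def fa_mult)
  have Dsum: "sum f B \<in> ?D" if "\<And>i. i \<in> B \<Longrightarrow> f i \<in> ?D" for f :: "(nat \<Rightarrow> nat) \<Rightarrow> _" and B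
    using that by (intro sum_closed) (auto simp: D0 Dadd)
  have pow: "fls_nth (t ^ k) q \<in> ?A" if "\<And>q. fls_nth t q \<in> ?A" for t :: "free_elem fls" and k q
    by (induction k arbitrary: q) (auto intro!: mult1 that simp: fa0 fa1)
  have Dgeom: "geom t \<in> ?D" if "\<And>q. fls_nth t q \<in> ?A" for t
    using pow[OF that] by (auto simp: coeffs_in_def geom_def fa0)
  have EM: "?E \<subseteq> carrier ?M" by (auto simp: mat_simps type_ring_simps PiE_iff)
  have Emult: "X \<otimes>\<^bsub>?M\<^esub> Y \<in> ?E" if "X \<in> ?E" "Y \<in> ?E" for X Y
    unfolding mat_simps using that
    by (intro mk_mat_mem) (auto simp: type_ring_simps type_ring_finsum fin mat_mem intro!: Dsum Dmult)
  have E1: "\<one>\<^bsub>?M\<^esub> \<in> ?E"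
    unfolding mat_simps by (intro mk_mat_mem) (auto simp: type_ring_simps D0 D1)
  interpret M: abelian_group ?M by (rule mat_abelian_group[OF type_ring_ring])
  have Eminus: "X \<ominus>\<^bsub>?M\<^esub> Y \<in> ?E" if X: "X \<in> ?E" and Y: "Y \<in> ?E" for X Y
  proof -
    have "X \<ominus>\<^bsub>?M\<^esub> Y = mk_mat ?I (\<lambda>i j. X i j - Y i j)"
    proof (rule mat_eqI[of _ _ UNIV])
      have "X \<ominus>\<^bsub>?M\<^esub> Y \<in> carrier ?M" using that EM by (intro M.minus_closed) auto
      then show "X \<ominus>\<^bsub>?M\<^esub> Y \<in> ?I \<rightarrow>\<^sub>E (?I \<rightarrow>\<^sub>E UNIV)" by (simp add: mat_simps type_ring_simps)
      fix i j assume "i \<in> ?I" "j \<in> ?I"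
      then show "(X \<ominus>\<^bsub>?M\<^esub> Y) i j = mk_mat ?I (\<lambda>i j. X i j - Y i j) i j"
        using that EM by (subst mat_minus_nth[OF type_ring_ring]) (auto simp: type_ring_minus)
    qed (intro mk_mat_mem, simp)
    then show ?thesis using that by (auto intro!: mk_mat_mem Ddiff simp: mat_mem)
  qed
  have Eflip: "mat_scale ?I ?K w (flip_op n 2 ?K 1 2) \<in> ?E" if "w \<in> ?D" for w
    unfolding mat_scale_def flip_op_def
    by (intro mk_mat_mem) (auto simp: type_ring_simps that D0)
  have Esite: "at_site n 2 ?K s X \<in> ?E"
    if "s \<in> {1..2}" "\<And>i j. i \<in> {1..n} \<Longrightarrow> j \<in> {1..n} \<Longrightarrow> X i j \<in> ?D" for s X
  proof -
    have "a s \<in> {1..n}" if "a \<in> ?I" for a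
      using that \<open>s \<in> {1..2}\<close> unfolding tensor_basis_def by (rule PiE_mem)
    then show ?thesis unfolding at_site_def using that(2)
      by (intro mk_mat_mem) (auto simp: type_ring_simps D0)
  qed
  have R: "\<one>\<^bsub>?M\<^esub> \<ominus>\<^bsub>?M\<^esub> mat_scale ?I ?K (geom t) (flip_op n 2 ?K 1 2) \<in> ?E"
    if "\<And>q. fls_nth t q \<in> ?A" for t
    by (intro Eminus E1 Eflip Dgeom that)
  have B1: "at_site n 2 ?K 1 (\<lambda>i j. fps_to_fls (Abs_fps (\<lambda>r. fls_const (gen i j r)))) \<in> ?E"
    by (rule Esite) (auto simp: coeffs_in_def fa_gen fa0)
  have B2: "at_site n 2 ?K 2 (\<lambda>i j. fls_const (fps_to_fls (Abs_fps (\<lambda>r. gen i j r)))) \<in> ?E"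
    by (rule Esite) (auto simp: coeffs_in_def fa_gen fa0)
  have *: "fls_nth (fls_nth (X a b - Y a b) p) q \<in> ?A"
    if "X \<in> ?E" "Y \<in> ?E" "a \<in> ?I" "b \<in> ?I" for X Y a b p q
    using Ddiff[OF mat_mem[OF that(1,3,4)] mat_mem[OF that(2,3,4)]]
    unfolding coeffs_in_def by blast
  have oE: "ordered_prod ?M xs \<in> ?E" if "set xs \<subseteq> ?E" for xs
    using that by (induction xs) (auto simp: ordered_prod_def E1 intro!: Emult simp del: PiE_iff)
  have Rm: "\<one>\<^bsub>?M\<^esub> \<ominus>\<^bsub>?M\<^esub> mat_scale ?I ?K (geom fls_X_inv) (flip_op n 2 ?K 1 2) \<in> ?E"
    and Rp: "\<one>\<^bsub>?M\<^esub> \<ominus>\<^bsub>?M\<^esub> mat_scale ?I ?K (geom (- fls_X_inv)) (flip_op n 2 ?K 1 2) \<in> ?E"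
    by (rule R, simp add: fa0 fa1 fa_uminus)+
  have "set [X, Y, Z, W] \<subseteq> ?E" if "X \<in> ?E" "Y \<in> ?E" "Z \<in> ?E" "W \<in> ?E" for X Y Z W
    using that by (simp only: list.set insert_subset empty_subsetI simp_thms)
  note o4 = oE[OF this]
  show ?thesis
    unfolding reflection_rels_def Let_def
    using *[OF o4[OF Rm B1 Rp B2] o4[OF B2 Rp B1 Rm]] by blast
qed

lemma reflection_ideal_ideal:
  "ideal (reflection_ideal m l) (free_algebra (letter_set (m + l)))"
  unfolding reflection_ideal_def
  using initial_rels_carrier unitary_rels_carrier reflection_rels_carrier
  by (intro ring.genideal_ideal[OF free_algebra_ring]) auto

lemma reflection_algebra_ring: "ring (reflection_algebra m l)"
  unfolding reflection_algebra_def
  by (rule ideal.quotient_is_ring[OF reflection_ideal_ideal])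

definition refl_class :: "nat \<Rightarrow> nat \<Rightarrow> free_elem \<Rightarrow> free_elem set" where
  "refl_class m l x = reflection_ideal m l +>\<^bsub>free_algebra (letter_set (m + l))\<^esub> x"

definition refl_scalar :: "nat \<Rightarrow> nat \<Rightarrow> complex \<Rightarrow> free_elem set" where
  "refl_scalar m l c = refl_class m l (free_const c)"

definition B_mat :: "nat \<Rightarrow> nat \<Rightarrow> nat \<Rightarrow> nat \<Rightarrow> nat \<Rightarrow> free_elem set" where
  "B_mat m l i j = (\<lambda>r. refl_class m l (gen i j r))"


section \<open>The product \<open>\<langle>\<langle>B\<^sub>1, \<dots>, B\<^sub>n\<rangle>\<rangle>\<close>\<close>

abbreviation refl_series :: "nat \<Rightarrow> nat \<Rightarrow> (nat \<Rightarrow> free_elem set) ring" where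
  "refl_series m l \<equiv> series_ring (reflection_algebra m l)"

type_synonym tensor_elem = "(nat \<Rightarrow> nat) \<Rightarrow> (nat \<Rightarrow> nat) \<Rightarrow> nat \<Rightarrow> free_elem set"

text \<open>\<open>End(\<complex>\<^sup>n)\<^sup>\<otimes>\<^sup>n \<otimes> \<B>(n, l)[[u\<^sup>-\<^sup>1]]\<close> with \<open>n = m + l\<close>\<close>

definition tensor_ring :: "nat \<Rightarrow> nat \<Rightarrow> tensor_elem ring" where
  "tensor_ring m l = mat_ring (tensor_basis (m + l) (m + l)) (refl_series m l)"

definition tensor_scale :: "nat \<Rightarrow> nat \<Rightarrow> complex fls \<Rightarrow> tensor_elem \<Rightarrow> tensor_elem" where
  "tensor_scale m l f =
    mat_scale (tensor_basis (m + l) (m + l)) (refl_series m l) (expand (refl_scalar m l) f)"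

definition P_op :: "nat \<Rightarrow> nat \<Rightarrow> nat \<Rightarrow> nat \<Rightarrow> tensor_elem" where
  "P_op m l = flip_op (m + l) (m + l) (refl_series m l)"

text \<open>\<open>B_op m l s c\<close> is \<open>B\<^sub>s(u - c)\<close>.\<close>

definition B_op :: "nat \<Rightarrow> nat \<Rightarrow> nat \<Rightarrow> nat \<Rightarrow> tensor_elem" where
  "B_op m l s c = at_site (m + l) (m + l) (refl_series m l) s
    (\<lambda>i j. shift_series (refl_scalar m l) (reflection_algebra m l) c (B_mat m l i j))"

definition Pi_op :: "nat \<Rightarrow> nat \<Rightarrow> nat \<Rightarrow> tensor_elem" where
  "Pi_op m l k = (let n = m + l in
    \<one>\<^bsub>tensor_ring m l\<^esub> \<ominus>\<^bsub>tensor_ring m l\<^esub>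
      tensor_scale m l (1 / (2 * uvar - of_nat k - of_nat n + 2))
        (\<Oplus>\<^bsub>tensor_ring m l\<^esub>i\<in>{k + 1..n}. P_op m l k i))"

definition bracket_B :: "nat \<Rightarrow> nat \<Rightarrow> tensor_elem" where
  "bracket_B m l = (let n = m + l in ordered_prod (tensor_ring m l)
    (concat (map (\<lambda>k. if k < n then [B_op m l k (k - 1), Pi_op m l k] else [B_op m l k (k - 1)])
      [1..<n + 1])))"


section \<open>Index tuples and permutations\<close>

definition index_tuples :: "nat \<Rightarrow> (nat \<Rightarrow> nat) set" where
  "index_tuples n = (\<Pi>\<^sub>E i\<in>{1..n}. {i..n})"

definition alpha :: "nat \<Rightarrow> (nat \<Rightarrow> nat) \<Rightarrow> complex fls" where
  "alpha n \<kappa> = (\<Prod>i\<in>{i\<in>{1..n}. i < \<kappa> i}. 1 / (of_nat n - 2 * uvar - 2 + of_nat i))"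

definition Q_inv :: "nat \<Rightarrow> nat \<Rightarrow> (nat \<Rightarrow> nat) \<Rightarrow> tensor_elem" where
  "Q_inv m l \<kappa> = ordered_prod (tensor_ring m l) (map (\<lambda>i. P_op m l i (\<kappa> i)) [1..<m + l + 1])"

definition q_perm :: "nat \<Rightarrow> (nat \<Rightarrow> nat) \<Rightarrow> nat \<Rightarrow> nat \<Rightarrow> nat" where
  "q_perm n \<kappa> i =
    foldr (\<circ>) (map (\<lambda>j. Transposition.transpose j (\<kappa> j)) (rev [i..<n + 1])) id"

end

theory Submission
  imports Defs
begin

text \<open>With \<open>P\<^sub>k\<^sub>k = 1\<close>, the operator \<open>\<Pi>\<^sub>k\<close> is the sum over \<open>j \<in> {k..n}\<close> of the \<open>P\<^sub>k\<^sub>j\<close>, with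
  coefficient \<open>1 / (n - 2u - 2 + k)\<close> for \<open>j > k\<close> and \<open>1\<close> for \<open>j = k\<close>. Expanding the product of the
  \<open>B\<^sub>k(u - k + 1) \<Pi>\<^sub>k\<close> therefore gives a sum over \<open>\<kappa> \<in> I\<^sub>n\<close>, in which the central scalars multiply to
  \<open>\<alpha>(\<kappa>)\<close>. In each summand, \<open>B\<^sub>s P\<^sub>i\<^sub>j = P\<^sub>i\<^sub>j B\<^sub>t\<close> with \<open>t = (i j)(s)\<close> moves every \<open>P\<close> to the left: the
  factor in position \<open>i\<close> passes exactly the flips with first index \<open>i, \<dots>, n\<close>, so that its site
  becomes \<open>q\<^sub>\<kappa>\<^sup>[\<^sup>i\<^sup>](i)\<close>.\<close>

section \<open>Sums and ordered products in rings\<close>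

lemma (in abelian_monoid) finsum_Times:
  assumes "finite A" "finite B" "\<And>a b. a \<in> A \<Longrightarrow> b \<in> B \<Longrightarrow> f (a, b) \<in> carrier G"
  shows "(\<Oplus>x\<in>A \<times> B. f x) = (\<Oplus>a\<in>A. \<Oplus>b\<in>B. f (a, b))"
  using assms(1,3)
proof (induction A rule: finite_induct)
  case empty
  then show ?case by simp
next
  case (insert x F)
  have "(\<Oplus>y\<in>insert x F \<times> B. f y) = (\<Oplus>y\<in>Pair x ` B \<union> F \<times> B. f y)"
    by (rule arg_cong[of _ _ "finsum G f"]) auto
  also have "\<dots> = (\<Oplus>y\<in>Pair x ` B. f y) \<oplus> (\<Oplus>y\<in>F \<times> B. f y)"
    using insert assms(2) by (intro finsum_Un_disjoint) auto
  also have "(\<Oplus>y\<in>Pair x ` B. f y) = (\<Oplus>b\<in>B. f (x, b))"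
    using insert by (intro finsum_reindex) (auto simp: inj_on_def)
  finally show ?case
    using insert by (subst finsum_insert) (auto intro!: finsum_closed)
qed

lemma (in abelian_monoid) finsum_swap:
  assumes "finite A" "finite B" "\<And>a b. a \<in> A \<Longrightarrow> b \<in> B \<Longrightarrow> f a b \<in> carrier G"
  shows "(\<Oplus>a\<in>A. \<Oplus>b\<in>B. f a b) = (\<Oplus>b\<in>B. \<Oplus>a\<in>A. f a b)"
  using assms(1,3)
proof (induction A rule: finite_induct)
  case empty
  then show ?case by simp
next
  case (insert x F)
  then show ?case
    by (simp add: finsum_closed finsum_addf Pi_def cong: finsum_cong)
qed

lemma ordered_prod_simps [simp]:
  "ordered_prod G [] = \<one>\<^bsub>G\<^esub>"
  "ordered_prod G (x # xs) = x \<otimes>\<^bsub>G\<^esub> ordered_prod G xs"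
  by (simp_all add: ordered_prod_def)

lemma (in Group.monoid) ordered_prod_closed:
  "set xs \<subseteq> carrier G \<Longrightarrow> ordered_prod G xs \<in> carrier G"
  by (induction xs) auto

lemma (in ring) ordered_prod_finsum:
  assumes "distinct xs" "\<And>i. i \<in> set xs \<Longrightarrow> finite (A i)"
    and "\<And>i j. i \<in> set xs \<Longrightarrow> j \<in> A i \<Longrightarrow> f i j \<in> carrier R"
  shows "ordered_prod R (map (\<lambda>i. \<Oplus>j\<in>A i. f i j) xs)
    = (\<Oplus>\<kappa>\<in>Pi\<^sub>E (set xs) A. ordered_prod R (map (\<lambda>i. f i (\<kappa> i)) xs))"
  using assms
proof (induction xs)
  case Nil
  then show ?case by simp
next
  case (Cons x xs)
  let ?S = "Pi\<^sub>E (set xs) A"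
  let ?g = "\<lambda>\<kappa>. ordered_prod R (map (\<lambda>i. f i (\<kappa> i)) xs)"
  let ?h = "\<lambda>\<kappa>. ordered_prod R (map (\<lambda>i. f i (\<kappa> i)) (x # xs))"
  have fin: "finite ?S" "finite (A x)" using Cons.prems by (auto intro!: finite_PiE)
  have g: "?g \<kappa> \<in> carrier R" if "\<kappa> \<in> ?S" for \<kappa>
    using that Cons.prems by (intro ordered_prod_closed) (auto simp: PiE_iff)
  have h: "?h (\<kappa>(x := j)) = f x j \<otimes> ?g \<kappa>" for \<kappa> j
    using Cons.prems(1) by (auto intro!: arg_cong[of _ _ "\<lambda>xs. _ \<otimes> ordered_prod R xs"])
  have "(\<Oplus>\<kappa>\<in>Pi\<^sub>E (set (x # xs)) A. ?h \<kappa>)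
      = (\<Oplus>\<kappa>\<in>(\<lambda>(j, \<kappa>). \<kappa>(x := j)) ` (A x \<times> ?S). ?h \<kappa>)"
    by (simp only: list.set PiE_insert_eq)
  also have "\<dots> = (\<Oplus>p\<in>A x \<times> ?S. ?h ((\<lambda>(j, \<kappa>). \<kappa>(x := j)) p))"
    using Cons.prems by (intro finsum_reindex inj_combinator)
      (auto intro!: m_closed g simp: h simp del: list.map ordered_prod_simps fun_upd_apply)
  also have "\<dots> = (\<Oplus>j\<in>A x. \<Oplus>\<kappa>\<in>?S. ?h (\<kappa>(x := j)))"
    using fin Cons.prems by (subst finsum_Times)
      (auto simp: h g simp del: list.map ordered_prod_simps fun_upd_apply)
  also have "\<dots> = (\<Oplus>j\<in>A x. \<Oplus>\<kappa>\<in>?S. f x j \<otimes> ?g \<kappa>)"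
    by (simp only: h)
  also have "\<dots> = (\<Oplus>j\<in>A x. f x j \<otimes> (\<Oplus>\<kappa>\<in>?S. ?g \<kappa>))"
    using Cons.prems fin g by (intro finsum_cong refl finsum_rdistr[symmetric])
      (auto simp: simp_implies_def intro!: finsum_rdistr[symmetric])
  also have "\<dots> = (\<Oplus>j\<in>A x. f x j) \<otimes> (\<Oplus>\<kappa>\<in>?S. ?g \<kappa>)"
    using Cons.prems fin g by (intro finsum_ldistr[symmetric]) auto
  also have "(\<Oplus>\<kappa>\<in>?S. ?g \<kappa>) = ordered_prod R (map (\<lambda>i. \<Oplus>j\<in>A i. f i j) xs)"
    using Cons by (intro Cons.IH[symmetric]) auto
  finally show ?case by simp
qed

section \<open>Rings of matrices and of series\<close>

lemma mat_mult_closed: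
  assumes "ring R" "X \<in> carrier (mat_ring I R)" "Y \<in> carrier (mat_ring I R)"
  shows "X \<otimes>\<^bsub>mat_ring I R\<^esub> Y \<in> carrier (mat_ring I R)"
proof -
  interpret R: ring R by fact
  show ?thesis using assms(2,3) unfolding mat_simps
    by (intro mk_mat_mem R.finsum_closed) (auto intro!: R.m_closed simp: mat_mem)
qed

lemma mat_ring_eqI:
  assumes "X \<in> carrier (mat_ring I R)" "Y \<in> carrier (mat_ring I R)"
    and "\<And>i j. i \<in> I \<Longrightarrow> j \<in> I \<Longrightarrow> X i j = Y i j"
  shows "X = Y"
  using assms unfolding mat_simps by (rule mat_eqI)

lemma mat_ring_ring:
  assumes "ring R" "finite I"
  shows "ring (mat_ring I R)"
proof -
  interpret R: ring R by fact
  let ?M = "mat_ring I R"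
  have nth: "(X \<otimes>\<^bsub>?M\<^esub> Y) i j = (\<Oplus>\<^bsub>R\<^esub>k\<in>I. X i k \<otimes>\<^bsub>R\<^esub> Y k j)"
    "(X \<oplus>\<^bsub>?M\<^esub> Y) i j = X i j \<oplus>\<^bsub>R\<^esub> Y i j"
    "\<one>\<^bsub>?M\<^esub> i j = (if i = j then \<one>\<^bsub>R\<^esub> else \<zero>\<^bsub>R\<^esub>)" if "i \<in> I" "j \<in> I" for X Y i j
    using that by (simp_all add: mat_simps)
  have mem: "X i j \<in> carrier R" if "X \<in> carrier ?M" "i \<in> I" "j \<in> I" for X i j
    using that by (simp add: mat_simps mat_mem)
  have one: "\<one>\<^bsub>?M\<^esub> \<in> carrier ?M"
    unfolding mat_simps by (intro mk_mat_mem) auto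
  note mult = mat_mult_closed[OF assms(1)]
  interpret A: abelian_group ?M by (rule mat_abelian_group[OF assms(1)])
  have assoc: "X \<otimes>\<^bsub>?M\<^esub> Y \<otimes>\<^bsub>?M\<^esub> Z = X \<otimes>\<^bsub>?M\<^esub> (Y \<otimes>\<^bsub>?M\<^esub> Z)"
    if X: "X \<in> carrier ?M" and Y: "Y \<in> carrier ?M" and Z: "Z \<in> carrier ?M" for X Y Z
  proof (rule mat_ring_eqI[of _ _ R])
    fix i j assume ij: "i \<in> I" "j \<in> I"
    have "(X \<otimes>\<^bsub>?M\<^esub> Y \<otimes>\<^bsub>?M\<^esub> Z) i j
        = (\<Oplus>\<^bsub>R\<^esub>k\<in>I. \<Oplus>\<^bsub>R\<^esub>h\<in>I. X i h \<otimes>\<^bsub>R\<^esub> Y h k \<otimes>\<^bsub>R\<^esub> Z k j)"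
      using ij X Y Z assms(2)
      by (auto simp: nth mem R.finsum_ldistr intro!: R.finsum_cong' R.finsum_closed)
    also have "\<dots> = (\<Oplus>\<^bsub>R\<^esub>h\<in>I. \<Oplus>\<^bsub>R\<^esub>k\<in>I. X i h \<otimes>\<^bsub>R\<^esub> Y h k \<otimes>\<^bsub>R\<^esub> Z k j)"
      using ij X Y Z assms(2) by (intro R.finsum_swap) (auto simp: mem)
    also have "\<dots> = (X \<otimes>\<^bsub>?M\<^esub> (Y \<otimes>\<^bsub>?M\<^esub> Z)) i j"
      using ij X Y Z assms(2)
      by (auto simp: nth mem R.finsum_rdistr R.m_assoc intro!: R.finsum_cong' R.finsum_closed)
    finally show "(X \<otimes>\<^bsub>?M\<^esub> Y \<otimes>\<^bsub>?M\<^esub> Z) i j = (X \<otimes>\<^bsub>?M\<^esub> (Y \<otimes>\<^bsub>?M\<^esub> Z)) i j" .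
  qed (intro mult X Y Z)+
  show ?thesis
  proof (intro ringI monoidI A.abelian_group_axioms)
    fix X assume X: "X \<in> carrier ?M"
    show "\<one>\<^bsub>?M\<^esub> \<otimes>\<^bsub>?M\<^esub> X = X"
    proof (rule mat_ring_eqI[of _ _ R])
      fix i j assume ij: "i \<in> I" "j \<in> I"
      have "(\<one>\<^bsub>?M\<^esub> \<otimes>\<^bsub>?M\<^esub> X) i j = (\<Oplus>\<^bsub>R\<^esub>k\<in>I. if i = k then X k j else \<zero>\<^bsub>R\<^esub>)"
        using ij X by (auto simp: nth mem intro!: R.finsum_cong')
      then show "(\<one>\<^bsub>?M\<^esub> \<otimes>\<^bsub>?M\<^esub> X) i j = X i j"
        using ij X assms(2) by (simp add: R.finsum_singleton mem)
    qed (intro mult X one)+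
    show "X \<otimes>\<^bsub>?M\<^esub> \<one>\<^bsub>?M\<^esub> = X"
    proof (rule mat_ring_eqI[of _ _ R])
      fix i j assume ij: "i \<in> I" "j \<in> I"
      have "(X \<otimes>\<^bsub>?M\<^esub> \<one>\<^bsub>?M\<^esub>) i j = (\<Oplus>\<^bsub>R\<^esub>k\<in>I. if j = k then X i k else \<zero>\<^bsub>R\<^esub>)"
        using ij X by (auto simp: nth mem intro!: R.finsum_cong')
      then show "(X \<otimes>\<^bsub>?M\<^esub> \<one>\<^bsub>?M\<^esub>) i j = X i j"
        using ij X assms(2) by (simp add: R.finsum_singleton mem)
    qed (intro mult X one)+
  next
    fix X Y Z assume XYZ: "X \<in> carrier ?M" "Y \<in> carrier ?M" "Z \<in> carrier ?M"
    show "X \<otimes>\<^bsub>?M\<^esub> Y \<otimes>\<^bsub>?M\<^esub> Z = X \<otimes>\<^bsub>?M\<^esub> (Y \<otimes>\<^bsub>?M\<^esub> Z)"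
      by (rule assoc[OF XYZ])
    show "(X \<oplus>\<^bsub>?M\<^esub> Y) \<otimes>\<^bsub>?M\<^esub> Z = X \<otimes>\<^bsub>?M\<^esub> Z \<oplus>\<^bsub>?M\<^esub> Y \<otimes>\<^bsub>?M\<^esub> Z"
    proof (rule mat_ring_eqI[of _ _ R])
      show "(X \<oplus>\<^bsub>?M\<^esub> Y) \<otimes>\<^bsub>?M\<^esub> Z \<in> carrier ?M" "X \<otimes>\<^bsub>?M\<^esub> Z \<oplus>\<^bsub>?M\<^esub> Y \<otimes>\<^bsub>?M\<^esub> Z \<in> carrier ?M"
        by (intro mult A.a_closed XYZ)+
      fix i j assume ij: "i \<in> I" "j \<in> I"
      have "((X \<oplus>\<^bsub>?M\<^esub> Y) \<otimes>\<^bsub>?M\<^esub> Z) i j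
          = (\<Oplus>\<^bsub>R\<^esub>k\<in>I. X i k \<otimes>\<^bsub>R\<^esub> Z k j \<oplus>\<^bsub>R\<^esub> Y i k \<otimes>\<^bsub>R\<^esub> Z k j)"
        unfolding nth(1)[OF ij] using ij XYZ by (intro R.finsum_cong') (auto simp: nth mem R.l_distr)
      also have "\<dots> = (X \<otimes>\<^bsub>?M\<^esub> Z \<oplus>\<^bsub>?M\<^esub> Y \<otimes>\<^bsub>?M\<^esub> Z) i j"
        using ij XYZ by (simp add: R.finsum_addf nth mem)
      finally show "((X \<oplus>\<^bsub>?M\<^esub> Y) \<otimes>\<^bsub>?M\<^esub> Z) i j = (X \<otimes>\<^bsub>?M\<^esub> Z \<oplus>\<^bsub>?M\<^esub> Y \<otimes>\<^bsub>?M\<^esub> Z) i j" .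
    qed
    show "Z \<otimes>\<^bsub>?M\<^esub> (X \<oplus>\<^bsub>?M\<^esub> Y) = Z \<otimes>\<^bsub>?M\<^esub> X \<oplus>\<^bsub>?M\<^esub> Z \<otimes>\<^bsub>?M\<^esub> Y"
    proof (rule mat_ring_eqI[of _ _ R])
      show "Z \<otimes>\<^bsub>?M\<^esub> (X \<oplus>\<^bsub>?M\<^esub> Y) \<in> carrier ?M" "Z \<otimes>\<^bsub>?M\<^esub> X \<oplus>\<^bsub>?M\<^esub> Z \<otimes>\<^bsub>?M\<^esub> Y \<in> carrier ?M"
        by (intro mult A.a_closed XYZ)+
      fix i j assume ij: "i \<in> I" "j \<in> I"
      have "(Z \<otimes>\<^bsub>?M\<^esub> (X \<oplus>\<^bsub>?M\<^esub> Y)) i j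
          = (\<Oplus>\<^bsub>R\<^esub>k\<in>I. Z i k \<otimes>\<^bsub>R\<^esub> X k j \<oplus>\<^bsub>R\<^esub> Z i k \<otimes>\<^bsub>R\<^esub> Y k j)"
        unfolding nth(1)[OF ij] using ij XYZ by (intro R.finsum_cong') (auto simp: nth mem R.r_distr)
      also have "\<dots> = (Z \<otimes>\<^bsub>?M\<^esub> X \<oplus>\<^bsub>?M\<^esub> Z \<otimes>\<^bsub>?M\<^esub> Y) i j"
        using ij XYZ by (simp add: R.finsum_addf nth mem)
      finally show "(Z \<otimes>\<^bsub>?M\<^esub> (X \<oplus>\<^bsub>?M\<^esub> Y)) i j = (Z \<otimes>\<^bsub>?M\<^esub> X \<oplus>\<^bsub>?M\<^esub> Z \<otimes>\<^bsub>?M\<^esub> Y) i j" .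
    qed
  qed (intro mult one; assumption)+
qed

lemma series_simps:
  "carrier (series_ring R) = UNIV \<rightarrow> carrier R"
  "f \<otimes>\<^bsub>series_ring R\<^esub> g = (\<lambda>r. \<Oplus>\<^bsub>R\<^esub>s\<in>{..r}. f s \<otimes>\<^bsub>R\<^esub> g (r - s))"
  "\<one>\<^bsub>series_ring R\<^esub> = (\<lambda>r. if r = 0 then \<one>\<^bsub>R\<^esub> else \<zero>\<^bsub>R\<^esub>)"
  "\<zero>\<^bsub>series_ring R\<^esub> = (\<lambda>r. \<zero>\<^bsub>R\<^esub>)"
  "f \<oplus>\<^bsub>series_ring R\<^esub> g = (\<lambda>r. f r \<oplus>\<^bsub>R\<^esub> g r)"
  by (simp_all add: series_ring_def)

lemma (in abelian_monoid) finsum_triangle: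
  fixes f :: "nat \<Rightarrow> nat \<Rightarrow> 'a"
  assumes "\<And>i j. f i j \<in> carrier G"
  shows "(\<Oplus>j\<in>{..n}. \<Oplus>i\<in>{..j}. f i (j - i)) = (\<Oplus>i\<in>{..n}. \<Oplus>j\<in>{..n - i}. f i j)"
proof (induction n)
  case 0
  then show ?case by (simp add: assms)
next
  case (Suc n)
  have "(\<Oplus>i\<in>{..n}. \<Oplus>j\<in>{..Suc n - i}. f i j)
      = (\<Oplus>i\<in>{..n}. f i (Suc n - i) \<oplus> (\<Oplus>j\<in>{..n - i}. f i j))"
    by (intro finsum_cong') (simp_all add: Suc_diff_le assms Pi_def finsum_closed del: finsum_addf)
  also have "\<dots> = (\<Oplus>i\<in>{..n}. f i (Suc n - i)) \<oplus> (\<Oplus>i\<in>{..n}. \<Oplus>j\<in>{..n - i}. f i j)"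
    by (intro finsum_addf) (simp_all add: assms finsum_closed)
  finally have 1: "(\<Oplus>i\<in>{..n}. \<Oplus>j\<in>{..Suc n - i}. f i j)
    = (\<Oplus>i\<in>{..n}. f i (Suc n - i)) \<oplus> (\<Oplus>j\<in>{..n}. \<Oplus>i\<in>{..j}. f i (j - i))"
    by (simp only: Suc)
  have 2: "(\<Oplus>i\<in>{..Suc n}. f i (Suc n - i)) = f (Suc n) 0 \<oplus> (\<Oplus>i\<in>{..n}. f i (Suc n - i))"
    by (subst finsum_Suc) (simp_all add: assms Pi_def)
  have 3: "(\<Oplus>i\<in>{..Suc n}. \<Oplus>j\<in>{..Suc n - i}. f i j)
      = f (Suc n) 0 \<oplus> (\<Oplus>i\<in>{..n}. \<Oplus>j\<in>{..Suc n - i}. f i j)"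
    by (subst finsum_Suc) (simp_all add: assms Pi_def finsum_closed)
  have "(\<Oplus>j\<in>{..Suc n}. \<Oplus>i\<in>{..j}. f i (j - i))
      = (\<Oplus>i\<in>{..Suc n}. f i (Suc n - i)) \<oplus> (\<Oplus>j\<in>{..n}. \<Oplus>i\<in>{..j}. f i (j - i))"
    by (subst finsum_Suc) (simp_all add: assms Pi_def finsum_closed del: finsum_Suc)
  then show ?case
    unfolding 1 2 3 by (simp only: a_assoc assms finsum_closed Pi_def mem_Collect_eq simp_thms)
qed

lemma (in ring) finsum_reverse:
  assumes "\<And>i. f i \<in> carrier R"
  shows "(\<Oplus>i\<in>{..n::nat}. f (n - i)) = (\<Oplus>i\<in>{..n}. f i)"
proof -
  have "i \<in> (\<lambda>i. n - i) ` {..n}" if "i \<le> n" for i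
    using that by (intro image_eqI[of _ _ "n - i"]) simp_all
  then have img: "(\<lambda>i. n - i) ` {..n} = {..n}" by auto
  have "(\<Oplus>i\<in>(\<lambda>i. n - i) ` {..n}. f i) = (\<Oplus>i\<in>{..n}. f (n - i))"
    by (intro finsum_reindex inj_on_inverseI[of _ "\<lambda>i. n - i"]) (simp_all add: assms)
  then show ?thesis by (simp only: img)
qed

lemma series_ring_ring:
  assumes "ring R"
  shows "ring (series_ring R)"
proof -
  interpret R: ring R by fact
  show ?thesis
  proof (intro ringI abelian_groupI monoidI)
    fix f assume f: "f \<in> carrier (series_ring R)"
    show "\<one>\<^bsub>series_ring R\<^esub> \<otimes>\<^bsub>series_ring R\<^esub> f = f"
    proof
      fix r
      have "(\<one>\<^bsub>series_ring R\<^esub> \<otimes>\<^bsub>series_ring R\<^esub> f) r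
          = (\<Oplus>\<^bsub>R\<^esub>s\<in>{..r}. if s = 0 then f (r - s) else \<zero>\<^bsub>R\<^esub>)"
        using f by (auto simp: series_simps Pi_iff intro!: R.finsum_cong')
      then show "(\<one>\<^bsub>series_ring R\<^esub> \<otimes>\<^bsub>series_ring R\<^esub> f) r = f r"
        using f by (simp add: series_simps R.add.finprod_singleton_swap Pi_iff)
    qed
    show "f \<otimes>\<^bsub>series_ring R\<^esub> \<one>\<^bsub>series_ring R\<^esub> = f"
    proof
      fix r
      have "(f \<otimes>\<^bsub>series_ring R\<^esub> \<one>\<^bsub>series_ring R\<^esub>) r
          = (\<Oplus>\<^bsub>R\<^esub>s\<in>{..r}. if r = s then f s else \<zero>\<^bsub>R\<^esub>)"
        using f by (auto simp: series_simps Pi_iff intro!: R.finsum_cong')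
      then show "(f \<otimes>\<^bsub>series_ring R\<^esub> \<one>\<^bsub>series_ring R\<^esub>) r = f r"
        using f by (simp add: series_simps R.finsum_singleton Pi_iff)
    qed
    show "\<exists>g\<in>carrier (series_ring R). g \<oplus>\<^bsub>series_ring R\<^esub> f = \<zero>\<^bsub>series_ring R\<^esub>"
      using f by (intro bexI[of _ "\<lambda>r. \<ominus>\<^bsub>R\<^esub> f r"]) (auto simp: series_simps Pi_iff R.l_neg)
  next
    fix f g h
    assume fgh: "f \<in> carrier (series_ring R)" "g \<in> carrier (series_ring R)"
      "h \<in> carrier (series_ring R)"
    show "f \<otimes>\<^bsub>series_ring R\<^esub> g \<otimes>\<^bsub>series_ring R\<^esub> h = f \<otimes>\<^bsub>series_ring R\<^esub> (g \<otimes>\<^bsub>series_ring R\<^esub> h)"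
    proof
      fix n
      have "(f \<otimes>\<^bsub>series_ring R\<^esub> g \<otimes>\<^bsub>series_ring R\<^esub> h) n
          = (\<Oplus>\<^bsub>R\<^esub>j\<in>{..n}. \<Oplus>\<^bsub>R\<^esub>i\<in>{..j}. f i \<otimes>\<^bsub>R\<^esub> g (j - i) \<otimes>\<^bsub>R\<^esub> h (n - (i + (j - i))))"
        using fgh by (auto simp: series_simps Pi_iff R.finsum_ldistr intro!: R.finsum_cong' R.finsum_closed)
      also have "\<dots> = (\<Oplus>\<^bsub>R\<^esub>i\<in>{..n}. \<Oplus>\<^bsub>R\<^esub>j\<in>{..n - i}. f i \<otimes>\<^bsub>R\<^esub> g j \<otimes>\<^bsub>R\<^esub> h (n - (i + j)))"
        using fgh by (intro R.finsum_triangle) (auto simp: series_simps Pi_iff)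
      also have "\<dots> = (f \<otimes>\<^bsub>series_ring R\<^esub> (g \<otimes>\<^bsub>series_ring R\<^esub> h)) n"
        using fgh by (auto simp: series_simps Pi_iff R.finsum_rdistr R.m_assoc diff_diff_left
            intro!: R.finsum_cong' R.finsum_closed)
      finally show "(f \<otimes>\<^bsub>series_ring R\<^esub> g \<otimes>\<^bsub>series_ring R\<^esub> h) n
        = (f \<otimes>\<^bsub>series_ring R\<^esub> (g \<otimes>\<^bsub>series_ring R\<^esub> h)) n" .
    qed
    show "(f \<oplus>\<^bsub>series_ring R\<^esub> g) \<otimes>\<^bsub>series_ring R\<^esub> h
        = f \<otimes>\<^bsub>series_ring R\<^esub> h \<oplus>\<^bsub>series_ring R\<^esub> g \<otimes>\<^bsub>series_ring R\<^esub> h"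
      using fgh by (simp add: series_simps Pi_iff R.l_distr)
    show "h \<otimes>\<^bsub>series_ring R\<^esub> (f \<oplus>\<^bsub>series_ring R\<^esub> g)
        = h \<otimes>\<^bsub>series_ring R\<^esub> f \<oplus>\<^bsub>series_ring R\<^esub> h \<otimes>\<^bsub>series_ring R\<^esub> g"
      using fgh by (simp add: series_simps Pi_iff R.r_distr)
  qed (simp_all add: series_simps Pi_iff R.a_ac)
qed

section \<open>Central scalars\<close>

definition central :: "('a, 'c) ring_scheme \<Rightarrow> 'a \<Rightarrow> bool" where
  "central R c \<longleftrightarrow> c \<in> carrier R \<and> (\<forall>x\<in>carrier R. c \<otimes>\<^bsub>R\<^esub> x = x \<otimes>\<^bsub>R\<^esub> c)"

lemma centralD:
  "central R c \<Longrightarrow> c \<in> carrier R"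
  "central R c \<Longrightarrow> x \<in> carrier R \<Longrightarrow> c \<otimes>\<^bsub>R\<^esub> x = x \<otimes>\<^bsub>R\<^esub> c"
  by (auto simp: central_def)

lemma (in ring) central_one: "central R \<one>"
  by (simp add: central_def)

lemma (in ring) central_mult:
  assumes "central R c" "central R d"
  shows "central R (c \<otimes> d)"
proof -
  note closed = assms[THEN centralD(1)]
  have "c \<otimes> d \<otimes> x = x \<otimes> (c \<otimes> d)" if x: "x \<in> carrier R" for x
  proof -
    have "c \<otimes> d \<otimes> x = c \<otimes> x \<otimes> d"
      using closed x by (simp add: m_assoc centralD(2)[OF assms(2) x])
    also have "\<dots> = x \<otimes> (c \<otimes> d)"
      using closed x by (simp add: centralD(2)[OF assms(1) x] flip: m_assoc)
    finally show ?thesis .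
  qed
  then show ?thesis
    using closed by (simp add: central_def)
qed

lemma (in ring) central_ordered_prod:
  "(\<And>x. x \<in> set xs \<Longrightarrow> central R x) \<Longrightarrow> central R (ordered_prod R xs)"
  by (induction xs) (auto intro: central_one central_mult)

locale matrices = ring R for R (structure) +
  fixes I :: "'i set"
  assumes finite_index: "finite I"
begin

abbreviation M where "M \<equiv> mat_ring I R"

sublocale M: ring M
  by (rule mat_ring_ring[OF ring_axioms finite_index])

lemma nth_closed: "X \<in> carrier M \<Longrightarrow> i \<in> I \<Longrightarrow> j \<in> I \<Longrightarrow> X i j \<in> carrier R"
  by (simp add: mat_simps mat_mem)

lemma mat_scale_closed:
  "c \<in> carrier R \<Longrightarrow> X \<in> carrier M \<Longrightarrow> mat_scale I R c X \<in> carrier M"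
  unfolding mat_scale_def mat_simps by (intro mk_mat_mem) (auto simp: mat_mem)

lemma mat_scale_add:
  assumes "c \<in> carrier R" "X \<in> carrier M" "Y \<in> carrier M"
  shows "mat_scale I R c (X \<oplus>\<^bsub>M\<^esub> Y) = mat_scale I R c X \<oplus>\<^bsub>M\<^esub> mat_scale I R c Y"
  by (rule mat_ring_eqI[of _ _ R])
    (insert assms, auto intro!: mat_scale_closed M.a_closed,
      simp add: mat_scale_def mat_simps nth_closed[OF assms(2)] nth_closed[OF assms(3)] r_distr)

lemma mat_scale_finsum:
  assumes "c \<in> carrier R" "finite A" "\<And>a. a \<in> A \<Longrightarrow> f a \<in> carrier M"
  shows "mat_scale I R c (\<Oplus>\<^bsub>M\<^esub>a\<in>A. f a) = (\<Oplus>\<^bsub>M\<^esub>a\<in>A. mat_scale I R c (f a))"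
  using assms(2,3)
proof (induction A rule: finite_induct)
  case empty
  show ?case
    by (rule mat_ring_eqI[of _ _ R]) (use assms(1) in \<open>auto intro!: mat_scale_closed\<close>,
        simp add: mat_scale_def mat_simps)
next
  case (insert a A)
  then show ?case
    by (simp add: mat_scale_add mat_scale_closed assms(1) M.finsum_closed Pi_def)
qed

lemma mat_scale_mult_left:
  assumes "c \<in> carrier R" "X \<in> carrier M" "Y \<in> carrier M"
  shows "mat_scale I R c X \<otimes>\<^bsub>M\<^esub> Y = mat_scale I R c (X \<otimes>\<^bsub>M\<^esub> Y)"
proof (rule mat_ring_eqI[of _ _ R])
  fix i j assume "i \<in> I" "j \<in> I"
  then show "(mat_scale I R c X \<otimes>\<^bsub>M\<^esub> Y) i j = mat_scale I R c (X \<otimes>\<^bsub>M\<^esub> Y) i j"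
    using assms finite_index
    by (auto simp: mat_scale_def mat_simps(2) nth_closed finsum_rdistr m_assoc intro!: finsum_cong')
qed (intro mat_scale_closed M.m_closed assms)+

lemma mat_scale_mult_right:
  assumes "central R c" "X \<in> carrier M" "Y \<in> carrier M"
  shows "X \<otimes>\<^bsub>M\<^esub> mat_scale I R c Y = mat_scale I R c (X \<otimes>\<^bsub>M\<^esub> Y)"
proof (rule mat_ring_eqI[of _ _ R])
  note c = centralD[OF assms(1)]
  fix i j assume ij: "i \<in> I" "j \<in> I"
  have "X i k \<otimes> (c \<otimes> Y k j) = c \<otimes> (X i k \<otimes> Y k j)" if "k \<in> I" for k
    using assms ij that c(1) c(2)[of "X i k"] by (simp add: nth_closed flip: m_assoc)
  then show "(X \<otimes>\<^bsub>M\<^esub> mat_scale I R c Y) i j = mat_scale I R c (X \<otimes>\<^bsub>M\<^esub> Y) i j"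
    using ij assms finite_index c(1)
    by (auto simp: mat_scale_def mat_simps(2) nth_closed finsum_rdistr intro!: finsum_cong')
qed (intro mat_scale_closed M.m_closed centralD(1)[OF assms(1)] assms)+

lemma mat_scale_mat_scale:
  assumes "c \<in> carrier R" "d \<in> carrier R" "X \<in> carrier M"
  shows "mat_scale I R c (mat_scale I R d X) = mat_scale I R (c \<otimes> d) X"
  by (rule mat_ring_eqI[of _ _ R])
    (insert assms, auto intro!: mat_scale_closed, simp add: mat_scale_def nth_closed m_assoc)

lemma mat_scale_one:
  "X \<in> carrier M \<Longrightarrow> mat_scale I R \<one> X = X"
  by (rule mat_ring_eqI[of _ _ R])
    (auto intro!: mat_scale_closed, simp add: mat_scale_def nth_closed)

lemma mat_scale_uminus:
  assumes "c \<in> carrier R" "X \<in> carrier M"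
  shows "\<ominus>\<^bsub>M\<^esub> mat_scale I R c X = mat_scale I R (\<ominus> c) X"
proof (rule M.minus_equality)
  show "mat_scale I R (\<ominus> c) X \<oplus>\<^bsub>M\<^esub> mat_scale I R c X = \<zero>\<^bsub>M\<^esub>"
    by (rule mat_ring_eqI[of _ _ R]) (insert assms, auto intro!: mat_scale_closed M.a_closed,
        simp add: mat_scale_def mat_simps nth_closed[OF assms(2)] l_minus l_neg)
qed (use assms in \<open>auto intro!: mat_scale_closed\<close>)

lemma ordered_prod_mat_scale:
  assumes "\<And>i. i \<in> set xs \<Longrightarrow> central R (c i)" "\<And>i. i \<in> set xs \<Longrightarrow> X i \<in> carrier M"
  shows "ordered_prod M (map (\<lambda>i. mat_scale I R (c i) (X i)) xs)
    = mat_scale I R (ordered_prod R (map c xs)) (ordered_prod M (map X xs))"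
  using assms
proof (induction xs)
  case Nil
  then show ?case by (simp add: mat_scale_one)
next
  case (Cons x xs)
  let ?c = "ordered_prod R (map c xs)" and ?X = "ordered_prod M (map X xs)"
  have central: "central R (c x)" "central R ?c"
    using Cons.prems(1) by (auto intro!: central_ordered_prod)
  have closed: "X x \<in> carrier M" "?X \<in> carrier M"
    using Cons.prems(2) by (auto intro!: M.ordered_prod_closed)
  have "mat_scale I R (c x) (X x) \<otimes>\<^bsub>M\<^esub> mat_scale I R ?c ?X
      = mat_scale I R (c x) (X x \<otimes>\<^bsub>M\<^esub> mat_scale I R ?c ?X)"
    by (intro mat_scale_mult_left mat_scale_closed closed central[THEN centralD(1)])
  also have "X x \<otimes>\<^bsub>M\<^esub> mat_scale I R ?c ?X = mat_scale I R ?c (X x \<otimes>\<^bsub>M\<^esub> ?X)"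
    by (intro mat_scale_mult_right closed central)
  also have "mat_scale I R (c x) \<dots> = mat_scale I R (c x \<otimes> ?c) (X x \<otimes>\<^bsub>M\<^esub> ?X)"
    by (intro mat_scale_mat_scale M.m_closed closed central[THEN centralD(1)])
  finally show ?case
    using Cons by simp
qed

end

section \<open>Matrices on tensor powers\<close>

locale tensor_matrices = ring R for R (structure) +
  fixes n N :: nat
begin

sublocale matrices R "tensor_basis n N"
  by unfold_locales (simp add: tensor_basis_def finite_PiE)

lemma at_site_closed:
  assumes "s \<in> {1..N}" "\<And>i j. i \<in> {1..n} \<Longrightarrow> j \<in> {1..n} \<Longrightarrow> X i j \<in> carrier R"
  shows "at_site n N R s X \<in> carrier M"
proof -
  have "a s \<in> {1..n}" if "a \<in> tensor_basis n N" for a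
    using that assms(1) unfolding tensor_basis_def by (rule PiE_mem)
  then show ?thesis
    unfolding at_site_def mat_simps using assms(2) by (intro mk_mat_mem) auto
qed

lemma flip_op_closed: "flip_op n N R i j \<in> carrier M"
  unfolding flip_op_def mat_simps by (intro mk_mat_mem) auto

lemma flip_op_self: "flip_op n N R i i = \<one>\<^bsub>M\<^esub>"
  by (simp add: flip_op_def mat_simps)

lemma tensor_basis_transpose:
  assumes "a \<in> tensor_basis n N" "i \<in> {1..N}" "j \<in> {1..N}"
  shows "a \<circ> Transposition.transpose i j \<in> tensor_basis n N"
  using assms unfolding tensor_basis_def
  by (auto simp: PiE_iff extensional_def Transposition.transpose_def)

lemma mult_flip_op:
  assumes "X \<in> carrier M" "i \<in> {1..N}" "j \<in> {1..N}" "a \<in> tensor_basis n N" "b \<in> tensor_basis n N"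
  shows "(X \<otimes>\<^bsub>M\<^esub> flip_op n N R i j) a b = X a (b \<circ> Transposition.transpose i j)"
proof -
  let ?b = "b \<circ> Transposition.transpose i j"
  have b: "?b \<in> tensor_basis n N" by (intro tensor_basis_transpose assms)
  have "(X \<otimes>\<^bsub>M\<^esub> flip_op n N R i j) a b
      = (\<Oplus>c\<in>tensor_basis n N. if c = ?b then X a c else \<zero>)"
    unfolding mat_simps mk_mat_nth[OF assms(4,5)]
    using assms by (intro finsum_cong') (auto simp: flip_op_def nth_closed)
  also have "\<dots> = X a ?b"
    using b assms finite_index by (subst add.finprod_singleton_swap) (auto simp: nth_closed)
  finally show ?thesis .
qed

lemma flip_op_mult:
  assumes "X \<in> carrier M" "i \<in> {1..N}" "j \<in> {1..N}" "a \<in> tensor_basis n N" "b \<in> tensor_basis n N"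
  shows "(flip_op n N R i j \<otimes>\<^bsub>M\<^esub> X) a b = X (a \<circ> Transposition.transpose i j) b"
proof -
  let ?a = "a \<circ> Transposition.transpose i j"
  have a: "?a \<in> tensor_basis n N" by (intro tensor_basis_transpose assms)
  have swap: "a = c \<circ> Transposition.transpose i j \<longleftrightarrow> c = ?a" for c
    by (auto simp: comp_assoc)
  have "(flip_op n N R i j \<otimes>\<^bsub>M\<^esub> X) a b
      = (\<Oplus>c\<in>tensor_basis n N. if c = ?a then X c b else \<zero>)"
    unfolding mat_simps mk_mat_nth[OF assms(4,5)]
    using assms by (intro finsum_cong') (auto simp: flip_op_def nth_closed swap)
  also have "\<dots> = X ?a b"
    using a assms finite_index by (subst add.finprod_singleton_swap) (auto simp: nth_closed)
  finally show ?thesis .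
qed

lemma at_site_flip_op:
  assumes ij: "i \<in> {1..N}" "j \<in> {1..N}" and s: "s \<in> {1..N}"
    and X: "\<And>i j. i \<in> {1..n} \<Longrightarrow> j \<in> {1..n} \<Longrightarrow> X i j \<in> carrier R"
  shows "at_site n N R s X \<otimes>\<^bsub>M\<^esub> flip_op n N R i j
    = flip_op n N R i j \<otimes>\<^bsub>M\<^esub> at_site n N R (Transposition.transpose i j s) X"
proof (rule mat_ring_eqI[of _ _ R])
  let ?t = "Transposition.transpose i j"
  have t: "?t s \<in> {1..N}" using ij s by (auto simp: Transposition.transpose_def)
  have closed: "at_site n N R s X \<in> carrier M" "at_site n N R (?t s) X \<in> carrier M"
    by (intro at_site_closed s t X; assumption)+
  show "at_site n N R s X \<otimes>\<^bsub>M\<^esub> flip_op n N R i j \<in> carrier M"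
    "flip_op n N R i j \<otimes>\<^bsub>M\<^esub> at_site n N R (?t s) X \<in> carrier M"
    by (intro M.m_closed flip_op_closed closed; assumption)+
  fix a b assume ab: "a \<in> tensor_basis n N" "b \<in> tensor_basis n N"
  have "(\<forall>r\<in>{1..N} - {s}. a r = b (?t r)) \<longleftrightarrow> (\<forall>r\<in>?t ` ({1..N} - {s}). a (?t r) = b r)"
    by simp
  also have "?t ` ({1..N} - {s}) = {1..N} - {?t s}"
  proof -
    have "?t ` {1..N} = {1..N}" using ij by simp
    then show ?thesis by (simp add: image_set_diff)
  qed
  finally have "at_site n N R s X a (b \<circ> ?t) = at_site n N R (?t s) X (a \<circ> ?t) b"
    using ab ij by (simp add: at_site_def tensor_basis_transpose)
  then show "(at_site n N R s X \<otimes>\<^bsub>M\<^esub> flip_op n N R i j) a b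
      = (flip_op n N R i j \<otimes>\<^bsub>M\<^esub> at_site n N R (?t s) X) a b"
    by (simp only: mult_flip_op[OF closed(1) ij ab] flip_op_mult[OF closed(2) ij ab])
qed

end

lemma q_perm_rec:
  "q_perm n \<kappa> (Suc n) = id"
  "k \<le> n \<Longrightarrow> q_perm n \<kappa> k = q_perm n \<kappa> (Suc k) \<circ> Transposition.transpose k (\<kappa> k)"
proof -
  show "q_perm n \<kappa> (Suc n) = id" by (simp add: q_perm_def)
  have *: "foldr (\<circ>) fs g = foldr (\<circ>) fs id \<circ> g" for fs :: "(nat \<Rightarrow> nat) list" and g
    by (induction fs) (simp_all add: comp_assoc)
  show "q_perm n \<kappa> k = q_perm n \<kappa> (Suc k) \<circ> Transposition.transpose k (\<kappa> k)" if "k \<le> n"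
    using that * by (simp add: q_perm_def upt_conv_Cons del: upt_Suc)
qed

context tensor_matrices
begin

lemma at_site_flips:
  assumes k: "1 \<le> k" "k \<le> Suc N" and \<kappa>: "\<And>i. i \<in> {1..N} \<Longrightarrow> \<kappa> i \<in> {1..N}" and s: "s \<in> {1..N}"
    and X: "\<And>i j. i \<in> {1..n} \<Longrightarrow> j \<in> {1..n} \<Longrightarrow> X i j \<in> carrier R"
  shows "q_perm N \<kappa> k s \<in> {1..N} \<and>
    at_site n N R s X \<otimes>\<^bsub>M\<^esub> ordered_prod M (map (\<lambda>i. flip_op n N R i (\<kappa> i)) [k..<N + 1])
      = ordered_prod M (map (\<lambda>i. flip_op n N R i (\<kappa> i)) [k..<N + 1])
        \<otimes>\<^bsub>M\<^esub> at_site n N R (q_perm N \<kappa> k s) X"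
  using k(2,1) s
proof (induction k arbitrary: s rule: inc_induct)
  case base
  then show ?case
    using at_site_closed[of s X] X by (simp add: q_perm_rec)
next
  case (step k)
  let ?s = "Transposition.transpose k (\<kappa> k) s" and ?F = "flip_op n N R k (\<kappa> k)"
  let ?Q = "ordered_prod M (map (\<lambda>i. flip_op n N R i (\<kappa> i)) [Suc k..<N + 1])"
  have s: "?s \<in> {1..N}" "q_perm N \<kappa> k s = q_perm N \<kappa> (Suc k) ?s"
    using step.hyps step.prems \<kappa>[of k] by (auto simp: Transposition.transpose_def q_perm_rec(2))
  have IH: "q_perm N \<kappa> (Suc k) ?s \<in> {1..N}"
    "at_site n N R ?s X \<otimes>\<^bsub>M\<^esub> ?Q = ?Q \<otimes>\<^bsub>M\<^esub> at_site n N R (q_perm N \<kappa> (Suc k) ?s) X"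
    using step.IH[of ?s] s by auto
  have closed: "?Q \<in> carrier M" "?F \<in> carrier M" "at_site n N R s X \<in> carrier M"
    "at_site n N R ?s X \<in> carrier M" "at_site n N R (q_perm N \<kappa> (Suc k) ?s) X \<in> carrier M"
    by (auto intro!: M.ordered_prod_closed flip_op_closed at_site_closed X step.prems s(1) IH(1)
        simp del: atLeastAtMost_iff upt_Suc)
  have "at_site n N R s X \<otimes>\<^bsub>M\<^esub> (?F \<otimes>\<^bsub>M\<^esub> ?Q) = at_site n N R s X \<otimes>\<^bsub>M\<^esub> ?F \<otimes>\<^bsub>M\<^esub> ?Q"
    using closed by (simp add: M.m_assoc)
  also have "at_site n N R s X \<otimes>\<^bsub>M\<^esub> ?F = ?F \<otimes>\<^bsub>M\<^esub> at_site n N R ?s X"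
    using step \<kappa>[of k] by (intro at_site_flip_op X) auto
  also have "\<dots> \<otimes>\<^bsub>M\<^esub> ?Q = ?F \<otimes>\<^bsub>M\<^esub> ?Q \<otimes>\<^bsub>M\<^esub> at_site n N R (q_perm N \<kappa> (Suc k) ?s) X"
    using closed IH(2) by (simp add: M.m_assoc)
  finally show ?case
    using step.hyps s IH(1) by (simp add: upt_conv_Cons del: upt_Suc)
qed

lemma ordered_prod_at_site_flip:
  assumes k: "1 \<le> k" "k \<le> Suc N" and \<kappa>: "\<And>i. i \<in> {1..N} \<Longrightarrow> \<kappa> i \<in> {1..N}"
    and X: "\<And>r i j. i \<in> {1..n} \<Longrightarrow> j \<in> {1..n} \<Longrightarrow> X r i j \<in> carrier R"
  shows "ordered_prod M (map (\<lambda>i. at_site n N R i (X i) \<otimes>\<^bsub>M\<^esub> flip_op n N R i (\<kappa> i)) [k..<N + 1])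
    = ordered_prod M (map (\<lambda>i. flip_op n N R i (\<kappa> i)) [k..<N + 1])
      \<otimes>\<^bsub>M\<^esub> ordered_prod M (map (\<lambda>i. at_site n N R (q_perm N \<kappa> i i) (X i)) [k..<N + 1])"
  using k(2,1)
proof (induction k rule: inc_induct)
  case base
  then show ?case by simp
next
  case (step k)
  let ?B = "at_site n N R k (X k)" and ?F = "flip_op n N R k (\<kappa> k)"
  let ?B' = "at_site n N R (q_perm N \<kappa> k k) (X k)"
  let ?Q = "ordered_prod M (map (\<lambda>i. flip_op n N R i (\<kappa> i)) [Suc k..<N + 1])"
  let ?T = "ordered_prod M (map (\<lambda>i. at_site n N R (q_perm N \<kappa> i i) (X i)) [Suc k..<N + 1])"
  have q: "q_perm N \<kappa> i i \<in> {1..N}" if "i \<in> {1..N}" for i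
    using at_site_flips[of i \<kappa> i "X i"] that \<kappa> X by auto
  have k: "k \<in> {1..N}" using step by auto
  have closed: "?B \<in> carrier M" "?F \<in> carrier M" "?B' \<in> carrier M" "?Q \<in> carrier M" "?T \<in> carrier M"
    using step.prems by (auto intro!: M.ordered_prod_closed flip_op_closed at_site_closed X k q
        simp del: upt_Suc)
  have "?B \<otimes>\<^bsub>M\<^esub> (?F \<otimes>\<^bsub>M\<^esub> ?Q) = ?F \<otimes>\<^bsub>M\<^esub> ?Q \<otimes>\<^bsub>M\<^esub> ?B'"
    using at_site_flips[of k \<kappa> k "X k"] k \<kappa> X step.hyps by (simp add: upt_conv_Cons del: upt_Suc)
  then have "?B \<otimes>\<^bsub>M\<^esub> ?F \<otimes>\<^bsub>M\<^esub> (?Q \<otimes>\<^bsub>M\<^esub> ?T) = ?F \<otimes>\<^bsub>M\<^esub> ?Q \<otimes>\<^bsub>M\<^esub> (?B' \<otimes>\<^bsub>M\<^esub> ?T)"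
    using closed by (simp flip: M.m_assoc)
  then show ?case
    using step by (simp add: upt_conv_Cons del: upt_Suc)
qed

end

section \<open>Expansions of rational functions\<close>

locale scalar_map = ring R for R (structure) +
  fixes \<iota> :: "complex \<Rightarrow> 'a"
  assumes scalar_central: "central R (\<iota> c)"
    and scalar_add: "\<iota> (c + d) = \<iota> c \<oplus> \<iota> d"
    and scalar_mult: "\<iota> (c * d) = \<iota> c \<otimes> \<iota> d"
    and scalar_one: "\<iota> 1 = \<one>"
begin

lemma scalar_closed: "\<iota> c \<in> carrier R"
  by (rule centralD(1)[OF scalar_central])

lemma scalar_zero: "\<iota> 0 = \<zero>"
  using scalar_add[of 0 0] scalar_closed[of 0] by (metis add.r_cancel_one' add_0)

lemma scalar_sum: "finite A \<Longrightarrow> \<iota> (\<Sum>a\<in>A. f a) = (\<Oplus>a\<in>A. \<iota> (f a))"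
  by (induction A rule: finite_induct) (simp_all add: scalar_zero scalar_add scalar_closed)

sublocale S: ring "series_ring R"
  by (rule series_ring_ring[OF ring_axioms])

lemma expand_closed: "expand \<iota> f \<in> carrier (series_ring R)"
  by (simp add: expand_def series_simps scalar_closed)

lemma expand_central: "central (series_ring R) (expand \<iota> f)"
proof -
  have "expand \<iota> f \<otimes>\<^bsub>series_ring R\<^esub> g = g \<otimes>\<^bsub>series_ring R\<^esub> expand \<iota> f"
    if g: "g \<in> carrier (series_ring R)" for g
  proof
    fix r
    have g': "g s \<in> carrier R" for s using g by (auto simp: series_simps)
    have "(\<Oplus>s\<in>{..r}. \<iota> (fls_nth f (int s)) \<otimes> g (r - s))
        = (\<Oplus>s\<in>{..r}. \<iota> (fls_nth f (int (r - (r - s)))) \<otimes> g (r - s))"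
      by (intro finsum_cong') (auto simp: scalar_closed g')
    also have "\<dots> = (\<Oplus>s\<in>{..r}. \<iota> (fls_nth f (int (r - s))) \<otimes> g s)"
      by (rule finsum_reverse[where f = "\<lambda>s. \<iota> (fls_nth f (int (r - s))) \<otimes> g s"])
        (simp add: scalar_closed g')
    also have "\<dots> = (\<Oplus>s\<in>{..r}. g s \<otimes> \<iota> (fls_nth f (int (r - s))))"
      by (intro finsum_cong') (auto simp: scalar_closed g' centralD(2)[OF scalar_central g'])
    finally show "(expand \<iota> f \<otimes>\<^bsub>series_ring R\<^esub> g) r = (g \<otimes>\<^bsub>series_ring R\<^esub> expand \<iota> f) r"
      by (simp add: series_simps expand_def)
  qed
  then show ?thesis
    by (simp add: central_def expand_closed)
qed

lemma expand_one: "expand \<iota> 1 = \<one>\<^bsub>series_ring R\<^esub>"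
  by (auto simp: expand_def series_simps scalar_one scalar_zero)

text \<open>The subdegree assumptions are needed because \<open>expand\<close> drops the positive powers of \<open>u\<close>.\<close>

lemma expand_mult:
  assumes "fls_subdegree f \<ge> 0" "fls_subdegree g \<ge> 0"
  shows "expand \<iota> (f * g) = expand \<iota> f \<otimes>\<^bsub>series_ring R\<^esub> expand \<iota> g"
proof
  fix r
  have "f * g = fps_to_fls (fls_regpart f * fls_regpart g)"
    using assms by (simp add: fls_times_fps_to_fls)
  then have "fls_nth (f * g) (int r) = (\<Sum>s\<le>r. fls_nth f (int s) * fls_nth g (int (r - s)))"
    by (simp add: fps_mult_nth atLeast0AtMost)
  then show "expand \<iota> (f * g) r = (expand \<iota> f \<otimes>\<^bsub>series_ring R\<^esub> expand \<iota> g) r"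
    by (simp add: expand_def series_simps scalar_sum scalar_mult del: of_nat_diff)
qed

lemma expand_uminus: "expand \<iota> (- f) = \<ominus>\<^bsub>series_ring R\<^esub> expand \<iota> f"
proof (rule S.minus_equality[symmetric])
  have "\<iota> (- c) \<oplus> \<iota> c = \<zero>" for c
    by (simp add: scalar_zero flip: scalar_add)
  then show "expand \<iota> (- f) \<oplus>\<^bsub>series_ring R\<^esub> expand \<iota> f = \<zero>\<^bsub>series_ring R\<^esub>"
    by (simp add: expand_def series_simps)
qed (rule expand_closed)+

lemma expand_prod_list:
  assumes "\<And>f. f \<in> set fs \<Longrightarrow> fls_subdegree f \<ge> 0"
  shows "fls_subdegree (prod_list fs) \<ge> 0 \<and>
    expand \<iota> (prod_list fs) = ordered_prod (series_ring R) (map (expand \<iota>) fs)"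
  using assms by (induction fs) (auto simp: expand_one expand_mult fls_mult_subdegree_ge_0)

lemma shift_series_closed:
  assumes "\<And>r. f r \<in> carrier R"
  shows "shift_series \<iota> R c f \<in> carrier (series_ring R)"
  using assms by (auto simp: shift_series_def series_simps scalar_closed intro!: finsum_closed)

end

lemma fls_subdegree_inverse_linear:
  assumes "a \<noteq> 0"
  shows "fls_subdegree (1 / (fls_const a * uvar + fls_const b)) \<ge> 0"
proof -
  have "fls_subdegree (fls_const a * uvar + fls_const b) \<le> - 1"
    using assms by (intro fls_subdegree_leI) (simp add: fls_X_inv_nth)
  then show ?thesis
    by (simp add: inverse_eq_divide[symmetric])
qed

section \<open>The reflection algebra\<close>

lemma free_const_central:
  fixes p :: "'a word \<Rightarrow>\<^sub>0 complex"
  shows "free_const c * p = p * free_const c"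
proof (induction p rule: Poly_Mapping.update_induct)
  case const
  show ?case by simp
next
  case (update p w d)
  have "Poly_Mapping.update w d p = p + Poly_Mapping.single w d"
    using update(1) by (intro poly_mapping_eqI)
      (auto simp: lookup_update lookup_add lookup_single in_keys_iff when_def)
  then show ?case
    using update(3) by (simp add: distrib_left distrib_right free_const_def mult_single mult.commute)
qed

lemma refl_class_hom:
  "refl_class m l \<in> ring_hom (free_algebra (letter_set (m + l))) (reflection_algebra m l)"
  unfolding refl_class_def [abs_def] reflection_algebra_def
  by (rule ideal.rcos_ring_hom[OF reflection_ideal_ideal])

lemma refl_scalar_map: "scalar_map (reflection_algebra m l) (refl_scalar m l)"
proof -
  let ?F = "free_algebra (letter_set (m + l))"
  note hom = refl_class_hom[of m l]
  have c: "free_const c \<in> carrier ?F" for c by (rule fa_const)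
  interpret ring "reflection_algebra m l" by (rule reflection_algebra_ring)
  show ?thesis
  proof
    fix c d
    show "refl_scalar m l (c + d) = refl_scalar m l c \<oplus>\<^bsub>reflection_algebra m l\<^esub> refl_scalar m l d"
      using ring_hom_add[OF hom c c, of c d] by (simp add: refl_scalar_def free_const_def single_add)
    show "refl_scalar m l (c * d) = refl_scalar m l c \<otimes>\<^bsub>reflection_algebra m l\<^esub> refl_scalar m l d"
      using ring_hom_mult[OF hom c c, of c d] by (simp add: refl_scalar_def free_const_def mult_single)
    show "refl_scalar m l 1 = \<one>\<^bsub>reflection_algebra m l\<^esub>"
      using ring_hom_one[OF hom] by (simp add: refl_scalar_def free_const_def)
    show "central (reflection_algebra m l) (refl_scalar m l c)"
      unfolding central_def refl_scalar_def
    proof (intro conjI ballI)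
      show "refl_class m l (free_const c) \<in> carrier (reflection_algebra m l)"
        by (rule ring_hom_closed[OF hom c])
      fix y assume "y \<in> carrier (reflection_algebra m l)"
      then obtain x where "x \<in> carrier ?F" "y = refl_class m l x"
        by (auto simp: reflection_algebra_def FactRing_def A_RCOSETS_def' refl_class_def)
      then show "refl_class m l (free_const c) \<otimes>\<^bsub>reflection_algebra m l\<^esub> y
          = y \<otimes>\<^bsub>reflection_algebra m l\<^esub> refl_class m l (free_const c)"
        using ring_hom_mult[OF hom c, of x c] ring_hom_mult[OF hom _ c, of x c]
        by (simp add: free_const_central)
    qed
  qed
qed

definition Pi_coeff :: "nat \<Rightarrow> nat \<Rightarrow> nat \<Rightarrow> complex fls" where
  "Pi_coeff n i j = (if i < j then 1 / (of_nat n - 2 * uvar - 2 + of_nat i) else 1)"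

lemma Pi_coeff_subdegree: "fls_subdegree (Pi_coeff n i j) \<ge> 0"
proof -
  have eq: "of_nat n - 2 * uvar - 2 + of_nat i
      = fls_const (-2) * uvar + fls_const (of_nat n - 2 + of_nat i :: complex)"
    by (simp add: fls_of_nat fls_const_numeral fls_plus_const[symmetric] fls_minus_const[symmetric])
  have "fls_subdegree (1 / (of_nat n - 2 * uvar - 2 + of_nat i)) \<ge> 0"
    unfolding eq by (rule fls_subdegree_inverse_linear) simp
  then show ?thesis
    by (simp add: Pi_coeff_def)
qed

lemma alpha_eq_prod_list: "alpha n \<kappa> = prod_list (map (\<lambda>i. Pi_coeff n i (\<kappa> i)) [1..<n + 1])"
proof -
  have "alpha n \<kappa> = (\<Prod>i\<in>{1..n}. Pi_coeff n i (\<kappa> i))"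
    unfolding alpha_def Pi_coeff_def by (rule prod.inter_filter) simp
  also have "\<dots> = (\<Prod>i\<in>set [1..<n + 1]. Pi_coeff n i (\<kappa> i))"
    by (rule prod.cong) auto
  finally show ?thesis
    by (simp only: prod.distinct_set_conv_list[OF distinct_upt])
qed

lemma (in Group.monoid) ordered_prod_concat_optional:
  assumes "\<And>x. x \<in> set xs \<Longrightarrow> f x \<in> carrier G" "\<And>x. x \<in> set xs \<Longrightarrow> P x \<Longrightarrow> g x \<in> carrier G"
  shows "ordered_prod G (concat (map (\<lambda>x. if P x then [f x, g x] else [f x]) xs))
    = ordered_prod G (map (\<lambda>x. f x \<otimes> (if P x then g x else \<one>)) xs)"
  using assms
proof (induction xs)
  case (Cons x xs)
  have "ordered_prod G (map (\<lambda>x. f x \<otimes> (if P x then g x else \<one>)) xs) \<in> carrier G"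
    using Cons.prems by (intro ordered_prod_closed) auto
  then show ?case
    using Cons by (auto simp: m_assoc)
qed simp

theorem proposition3:
  fixes m l n :: nat
  assumes "n = m + l"
  shows "bracket_B m l =
    (\<Oplus>\<^bsub>tensor_ring m l\<^esub>\<kappa>\<in>index_tuples n.
      tensor_scale m l (alpha n \<kappa>)
        (Q_inv m l \<kappa> \<otimes>\<^bsub>tensor_ring m l\<^esub>
          ordered_prod (tensor_ring m l)
            (map (\<lambda>i. B_op m l (q_perm n \<kappa> i i) (i - 1)) [1..<n + 1])))"
proof -
  interpret A: scalar_map "reflection_algebra m l" "refl_scalar m l"
    by (rule refl_scalar_map)
  interpret T: tensor_matrices "refl_series m l" n n
    by (intro tensor_matrices.intro A.S.ring_axioms)
  let ?M = "tensor_ring m l"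
  let ?e = "expand (refl_scalar m l)"
  let ?X = "\<lambda>c i j. shift_series (refl_scalar m l) (reflection_algebra m l) c (B_mat m l i j)"
  let ?B = "\<lambda>k. B_op m l k (k - 1)"
  have M: "?M = mat_ring (tensor_basis n n) (refl_series m l)"
    and scale: "tensor_scale m l f = mat_scale (tensor_basis n n) (refl_series m l) (?e f)"
    and P: "P_op m l = flip_op n n (refl_series m l)"
    and B: "B_op m l s c = at_site n n (refl_series m l) s (?X c)" for f s c
    by (simp_all add: assms tensor_ring_def tensor_scale_def P_op_def B_op_def)
  have X_closed: "?X c i j \<in> carrier (refl_series m l)" if "i \<in> {1..n}" "j \<in> {1..n}" for c i j
    using that unfolding B_mat_def assms
    by (intro A.shift_series_closed ring_hom_closed[OF refl_class_hom] fa_gen)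
  have B_closed: "?B k \<in> carrier ?M" if "k \<in> {1..n}" for k
    unfolding B M by (intro T.at_site_closed that X_closed)
  have P_closed: "P_op m l i j \<in> carrier ?M" for i j
    unfolding P M by (rule T.flip_op_closed)
  have scale_closed: "tensor_scale m l f Y \<in> carrier ?M" if "Y \<in> carrier ?M" for f Y
    using that unfolding scale M by (intro T.mat_scale_closed A.expand_closed)
  interpret M: ring ?M
    unfolding M by (rule T.M.ring_axioms)

  have Pi: "(if k < n then Pi_op m l k else \<one>\<^bsub>?M\<^esub>)
      = (\<Oplus>\<^bsub>?M\<^esub>j\<in>{k..n}. tensor_scale m l (Pi_coeff n k j) (P_op m l k j))"
    if k: "k \<in> {1..n}" for k
  proof -
    let ?f = "1 / (2 * uvar - of_nat k - of_nat n + 2)"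
    let ?Y = "\<Oplus>\<^bsub>?M\<^esub>i\<in>{k + 1..n}. P_op m l k i"
    have diag: "tensor_scale m l (Pi_coeff n k k) (P_op m l k k) = \<one>\<^bsub>?M\<^esub>"
      using T.mat_scale_one[OF T.M.one_closed]
      by (simp add: Pi_coeff_def A.expand_one scale P M T.flip_op_self)
    have coeff: "- ?f = Pi_coeff n k j" if "k < j" for j
    proof -
      have "of_nat n - 2 * uvar - 2 + of_nat k = - (2 * uvar - of_nat k - of_nat n + 2)"
        by simp
      then show ?thesis using that by (simp only: Pi_coeff_def if_True divide_minus_right)
    qed
    have "\<ominus>\<^bsub>?M\<^esub> tensor_scale m l ?f ?Y = tensor_scale m l (- ?f) ?Y"
      unfolding scale M A.expand_uminus
      by (intro T.mat_scale_uminus A.expand_closed T.M.finsum_closed) (simp add: P T.flip_op_closed)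
    also have "\<dots> = (\<Oplus>\<^bsub>?M\<^esub>i\<in>{k + 1..n}. tensor_scale m l (- ?f) (P_op m l k i))"
      unfolding scale M by (intro T.mat_scale_finsum A.expand_closed) (simp_all add: P T.flip_op_closed)
    also have "\<dots> = (\<Oplus>\<^bsub>?M\<^esub>j\<in>{k + 1..n}. tensor_scale m l (Pi_coeff n k j) (P_op m l k j))"
    proof (intro M.finsum_cong' refl Pi_I scale_closed P_closed)
      fix j assume "j \<in> {k + 1..n}"
      then show "tensor_scale m l (- ?f) (P_op m l k j) = tensor_scale m l (Pi_coeff n k j) (P_op m l k j)"
        by (subst coeff[of j]) auto
    qed
    finally have minus: "\<ominus>\<^bsub>?M\<^esub> tensor_scale m l ?f ?Y = \<dots>" .
    have "{k..n} = insert k {k + 1..n}" using k by auto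
    then have "(\<Oplus>\<^bsub>?M\<^esub>j\<in>{k..n}. tensor_scale m l (Pi_coeff n k j) (P_op m l k j))
        = \<one>\<^bsub>?M\<^esub> \<oplus>\<^bsub>?M\<^esub> \<ominus>\<^bsub>?M\<^esub> tensor_scale m l ?f ?Y"
      unfolding minus by (simp add: diag scale_closed P_closed)
    moreover have "\<ominus>\<^bsub>?M\<^esub> tensor_scale m l ?f ?Y = \<zero>\<^bsub>?M\<^esub>" if "\<not> k < n"
      unfolding minus using that by simp
    ultimately show ?thesis
      by (auto simp: Pi_op_def Let_def a_minus_def assms)
  qed

  have factor: "?B k \<otimes>\<^bsub>?M\<^esub> (if k < n then Pi_op m l k else \<one>\<^bsub>?M\<^esub>)
      = (\<Oplus>\<^bsub>?M\<^esub>j\<in>{k..n}. tensor_scale m l (Pi_coeff n k j) (?B k \<otimes>\<^bsub>?M\<^esub> P_op m l k j))"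
    if k: "k \<in> {1..n}" for k
  proof -
    have "?B k \<otimes>\<^bsub>?M\<^esub> tensor_scale m l f (P_op m l k j)
        = tensor_scale m l f (?B k \<otimes>\<^bsub>?M\<^esub> P_op m l k j)" for f j
      using B_closed[OF k] P_closed unfolding scale M
      by (intro T.mat_scale_mult_right A.expand_central)
    then show ?thesis
      unfolding Pi[OF k] using B_closed[OF k] P_closed scale_closed
      by (subst M.finsum_rdistr) (auto intro!: M.finsum_cong')
  qed

  have summand: "ordered_prod ?M
        (map (\<lambda>k. tensor_scale m l (Pi_coeff n k (\<kappa> k)) (?B k \<otimes>\<^bsub>?M\<^esub> P_op m l k (\<kappa> k))) [1..<n + 1])
      = tensor_scale m l (alpha n \<kappa>) (Q_inv m l \<kappa> \<otimes>\<^bsub>?M\<^esub>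
          ordered_prod ?M (map (\<lambda>i. B_op m l (q_perm n \<kappa> i i) (i - 1)) [1..<n + 1]))"
    if \<kappa>: "\<kappa> \<in> index_tuples n" for \<kappa>
  proof -
    have \<kappa>': "\<kappa> i \<in> {1..n}" if "i \<in> {1..n}" for i
      using PiE_mem[OF \<kappa>[unfolded index_tuples_def] that] that by auto
    have "ordered_prod ?M
        (map (\<lambda>k. tensor_scale m l (Pi_coeff n k (\<kappa> k)) (?B k \<otimes>\<^bsub>?M\<^esub> P_op m l k (\<kappa> k))) [1..<n + 1])
      = mat_scale (tensor_basis n n) (refl_series m l)
          (ordered_prod (refl_series m l) (map (\<lambda>k. ?e (Pi_coeff n k (\<kappa> k))) [1..<n + 1]))
          (ordered_prod ?M (map (\<lambda>k. ?B k \<otimes>\<^bsub>?M\<^esub> P_op m l k (\<kappa> k)) [1..<n + 1]))"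
      unfolding scale M
    proof (intro T.ordered_prod_mat_scale A.expand_central T.M.m_closed)
      fix k assume "k \<in> set [1..<n + 1]"
      then show "?B k \<in> carrier (mat_ring (tensor_basis n n) (refl_series m l))"
        "P_op m l k (\<kappa> k) \<in> carrier (mat_ring (tensor_basis n n) (refl_series m l))"
        using B_closed[of k] P_closed unfolding M by auto
    qed
    also have "ordered_prod (refl_series m l) (map (\<lambda>k. ?e (Pi_coeff n k (\<kappa> k))) [1..<n + 1])
        = ?e (alpha n \<kappa>)"
    proof -
      let ?fs = "map (\<lambda>k. Pi_coeff n k (\<kappa> k)) [1..<n + 1]"
      have "fls_subdegree f \<ge> 0" if "f \<in> set ?fs" for f
        using that by (auto simp: Pi_coeff_subdegree)
      from A.expand_prod_list[of ?fs, OF this] show ?thesis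
        by (simp add: alpha_eq_prod_list comp_def del: upt_Suc)
    qed
    also have "ordered_prod ?M (map (\<lambda>k. ?B k \<otimes>\<^bsub>?M\<^esub> P_op m l k (\<kappa> k)) [1..<n + 1])
        = Q_inv m l \<kappa> \<otimes>\<^bsub>?M\<^esub>
          ordered_prod ?M (map (\<lambda>i. B_op m l (q_perm n \<kappa> i i) (i - 1)) [1..<n + 1])"
      unfolding Q_inv_def assms[symmetric] B P M
      by (intro T.ordered_prod_at_site_flip \<kappa>' X_closed) auto
    finally show ?thesis
      by (simp only: scale)
  qed

  have "bracket_B m l
      = ordered_prod ?M (map (\<lambda>k. ?B k \<otimes>\<^bsub>?M\<^esub> (if k < n then Pi_op m l k else \<one>\<^bsub>?M\<^esub>)) [1..<n + 1])"
    unfolding bracket_B_def Let_def assms[symmetric]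
  proof (intro M.ordered_prod_concat_optional)
    fix k assume k: "k \<in> set [1..<n + 1]"
    then show "?B k \<in> carrier ?M" by (intro B_closed) auto
    show "Pi_op m l k \<in> carrier ?M" if "k < n"
      using Pi[of k] k that scale_closed P_closed by (auto intro!: M.finsum_closed)
  qed
  also have "\<dots> = ordered_prod ?M (map (\<lambda>k. \<Oplus>\<^bsub>?M\<^esub>j\<in>{k..n}.
      tensor_scale m l (Pi_coeff n k j) (?B k \<otimes>\<^bsub>?M\<^esub> P_op m l k j)) [1..<n + 1])"
    by (intro arg_cong[of _ _ "ordered_prod ?M"] map_cong refl factor) auto
  also have "\<dots> = (\<Oplus>\<^bsub>?M\<^esub>\<kappa>\<in>Pi\<^sub>E (set [1..<n + 1]) (\<lambda>k. {k..n}). ordered_prod ?M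
      (map (\<lambda>k. tensor_scale m l (Pi_coeff n k (\<kappa> k)) (?B k \<otimes>\<^bsub>?M\<^esub> P_op m l k (\<kappa> k))) [1..<n + 1]))"
    by (intro M.ordered_prod_finsum) (auto intro!: scale_closed M.m_closed B_closed[unfolded One_nat_def] P_closed)
  also have "Pi\<^sub>E (set [1..<n + 1]) (\<lambda>k. {k..n}) = index_tuples n"
    by (simp only: index_tuples_def set_upt atLeastLessThanSuc_atLeastAtMost Suc_eq_plus1[symmetric])
  also have "(\<Oplus>\<^bsub>?M\<^esub>\<kappa>\<in>index_tuples n. ordered_prod ?M
      (map (\<lambda>k. tensor_scale m l (Pi_coeff n k (\<kappa> k)) (?B k \<otimes>\<^bsub>?M\<^esub> P_op m l k (\<kappa> k))) [1..<n + 1]))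
    = (\<Oplus>\<^bsub>?M\<^esub>\<kappa>\<in>index_tuples n. tensor_scale m l (alpha n \<kappa>) (Q_inv m l \<kappa> \<otimes>\<^bsub>?M\<^esub>
          ordered_prod ?M (map (\<lambda>i. B_op m l (q_perm n \<kappa> i i) (i - 1)) [1..<n + 1])))"
  proof (intro M.finsum_cong' refl summand Pi_I)
    fix \<kappa> assume \<kappa>: "\<kappa> \<in> index_tuples n"
    show "tensor_scale m l (alpha n \<kappa>) (Q_inv m l \<kappa> \<otimes>\<^bsub>?M\<^esub>
        ordered_prod ?M (map (\<lambda>i. B_op m l (q_perm n \<kappa> i i) (i - 1)) [1..<n + 1])) \<in> carrier ?M"
      unfolding summand[OF \<kappa>, symmetric]
      by (rule M.ordered_prod_closed)
        (auto intro!: scale_closed M.m_closed B_closed[unfolded One_nat_def] P_closed)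
  qed
  finally show ?thesis .
qed

end
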